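(* Consider either long-range percolation on $\mathbb{Z}^d$ or Bernoulli nearest-neighbor bond percolation on $\mathbb{Z}^d$, $d\ge 1$, with parameters such that $\theta<1$. For all $\rho\in(\theta,1)$ there exists $A>0$ such that for all $n\ge 1$, $$-A\;\le\;\frac1n\log\mathbb{P}\big(|\mathcal{C}_n^{(1)}|>\rho n\big)\;\le\;-\frac1A .$$
   Context: Long-range percolation on $\mathbb{Z}^d$: for parameters $p\in(0,1]$, $\beta>0$, $\alpha\in(1,\infty)$, the vertex set is $\mathbb{Z}^d$ and each pair $x\ne y$ is joined by an edge independently with probability $p\,\min\{1,\beta/\|x-y\|^{d}\}^{\alpha}$, where $\|\cdot\|$ is the Euclidean norm. Bernoulli nearest-neighbor bond percolation on $\mathbb{Z}^d$: each edge between two vertices of $\mathbb{Z}^d$ at Euclidean distance one is present independently with a fixed probability $q\in(0,1]$, and there are no other edges. $\theta:=\mathbb{P}(|\mathcal{C}(0)|=\infty)$, where $\mathcal{C}(0)$ is the connected component of the origin in the infinite graph. $\Lambda_n:=[-n^{1/d}/2,n^{1/d}/2]^d$; $\mathcal{C}_n^{(1)}$ is a largest connected component of the subgraph induced by the vertices in $\Lambda_n$, and $|\cdot|$ denotes the number of vertices. No assumption of super- or subcriticality is made.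
   Formalization: "For all n ≥ 1" is restricted to those n with 1 ≤ ρn < number of lattice points in Λ_n; for the finitely many other n the probability is 1 or 0 (e.g. n = 1), so the claimed bounds fail. *)

theory Defs
  imports "HOL-Probability.Probability"
begin

section \<open>Graphs given by their set of edges\<close>

text \<open>A simple graph is given by its set of edges, each edge being a two-element set
  of vertices.\<close>

definition vertex_pairs :: "'v set set" where
  "vertex_pairs = {{x, y} | x y. x \<noteq> y}"

definition cluster :: "'v set set \<Rightarrow> 'v \<Rightarrow> 'v set" where
  "cluster G x = {y. (x, y) \<in> {(u, v). {u, v} \<in> G}\<^sup>*}"

definition induced_subgraph :: "'v set set \<Rightarrow> 'v set \<Rightarrow> 'v set set" where
  "induced_subgraph G V = {e \<in> G. e \<subseteq> V}"

definition components_on :: "'v set set \<Rightarrow> 'v set \<Rightarrow> 'v set set" where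
  "components_on G V = cluster (induced_subgraph G V) ` V"

text \<open>The number of vertices of a largest component; meant for finite nonempty \<open>V\<close>.\<close>

definition largest_component_size :: "'v set set \<Rightarrow> 'v set \<Rightarrow> nat" where
  "largest_component_size G V = Max (card ` components_on G V)"


section \<open>Bond percolation on the integer lattice\<close>

text \<open>The lattice is the type \<open>int ^ 'd\<close>, of dimension \<open>CARD('d)\<close>.\<close>

definition eucl_dist :: "int ^ 'd \<Rightarrow> int ^ 'd \<Rightarrow> real" where
  "eucl_dist x y = norm ((\<chi> i. real_of_int (x $ i - y $ i)) :: real ^ 'd)"

text \<open>The lattice points in the closed cube of volume \<open>n\<close> centred at the origin.\<close>

definition lattice_box :: "nat \<Rightarrow> (int ^ 'd) set" where
  "lattice_box n = {x. \<forall>i. real_of_int (x $ i) \<in>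
     {- (real n powr (1 / real CARD('d)) / 2) .. real n powr (1 / real CARD('d)) / 2}}"

text \<open>A random graph (\<open>E \<omega>\<close> is its set of edges) in which distinct \<open>x\<close>, \<open>y\<close> are joined with
  probability \<open>\<kappa> x y\<close>, independently over unordered pairs.\<close>

locale bond_percolation = prob_space M
  for M :: "'w measure"
    and E :: "'w \<Rightarrow> (int ^ 'd) set set"
    and \<kappa> :: "int ^ 'd \<Rightarrow> int ^ 'd \<Rightarrow> real" +
  assumes edges: "\<And>\<omega>. \<omega> \<in> space M \<Longrightarrow> E \<omega> \<subseteq> vertex_pairs"
    and edges_indep: "indep_events (\<lambda>e. {\<omega> \<in> space M. e \<in> E \<omega>}) vertex_pairs"
    and edge_prob: "\<And>x y. x \<noteq> y \<Longrightarrow> prob {\<omega> \<in> space M. {x, y} \<in> E \<omega>} = \<kappa> x y"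

locale long_range_percolation =
  bond_percolation M E
    "\<lambda>x y. p * (min 1 (\<beta> / eucl_dist x y ^ CARD('d))) powr \<alpha>"
  for M :: "'w measure"
    and E :: "'w \<Rightarrow> (int ^ 'd) set set"
    and p \<beta> \<alpha> :: real +
  assumes p: "0 < p" "p \<le> 1"
    and \<beta>: "0 < \<beta>"
    and \<alpha>: "1 < \<alpha>"

locale nearest_neighbor_percolation =
  bond_percolation M E "\<lambda>x y. if eucl_dist x y = 1 then q else 0"
  for M :: "'w measure"
    and E :: "'w \<Rightarrow> (int ^ 'd) set set"
    and q :: real +
  assumes q: "0 < q" "q \<le> 1"

definition percolation_prob :: "'w measure \<Rightarrow> ('w \<Rightarrow> (int ^ 'd) set set) \<Rightarrow> real" where
  "percolation_prob M E = measure M {\<omega> \<in> space M. infinite (cluster (E \<omega>) 0)}"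

definition large_component_prob ::
    "'w measure \<Rightarrow> ('w \<Rightarrow> (int ^ 'd) set set) \<Rightarrow> real \<Rightarrow> nat \<Rightarrow> real" where
  "large_component_prob M E \<rho> n =
     measure M {\<omega> \<in> space M.
       real (largest_component_size (E \<omega>) (lattice_box n)) > \<rho> * real n}"


section \<open>Degenerate box sizes\<close>

text \<open>A largest component in the box has at least one vertex and at most as many as the box.
  So \<open>large_component_prob M E \<rho> n\<close> is \<open>1\<close> if \<open>\<rho> * n < 1\<close>, which for \<open>\<rho> < 1\<close> includes \<open>n = 1\<close>,
  and it is \<open>0\<close> if the box has at most \<open>\<rho> * n\<close> vertices (such as \<open>n = 3\<close>, \<open>\<rho> \<ge> 1/3\<close> in
  dimension two). In the first case the logarithm of the probability is zero, in the second it is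
  minus infinity. The following excludes precisely these \<open>n\<close>; for \<open>0 < \<rho> < 1\<close> there are only
  finitely many of them.\<close>

definition nondegenerate_size :: "'d::finite itself \<Rightarrow> real \<Rightarrow> nat \<Rightarrow> bool" where
  "nondegenerate_size _ \<rho> n \<longleftrightarrow>
     1 \<le> \<rho> * real n \<and> \<rho> * real n < real (card (lattice_box n :: (int ^ 'd) set))"

lemma card_vec_Collect:
  fixes S :: "'a set"
  assumes "finite S"
  shows "finite {x :: 'a ^ 'd. \<forall>i. x $ i \<in> S}"
    and "card {x :: 'a ^ 'd. \<forall>i. x $ i \<in> S} = card S ^ CARD('d)"
proof -
  have "{x :: 'a ^ 'd. \<forall>i. x $ i \<in> S} = vec_lambda ` (PiE UNIV (\<lambda>_. S))" (is "?L = ?R")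
  proof (intro equalityI subsetI)
    fix x assume "x \<in> ?L"
    then have "x = vec_lambda (vec_nth x)" "vec_nth x \<in> PiE UNIV (\<lambda>_. S)"
      by auto
    then show "x \<in> ?R" by blast
  next
    fix x assume "x \<in> ?R"
    then show "x \<in> ?L" by (auto simp: PiE_iff)
  qed
  moreover have "inj_on (vec_lambda :: ('d \<Rightarrow> 'a) \<Rightarrow> _) (PiE UNIV (\<lambda>_. S))"
    by (metis inj_onI vec_lambda_inverse UNIV_I)
  ultimately show "finite {x :: 'a ^ 'd. \<forall>i. x $ i \<in> S}"
    and "card {x :: 'a ^ 'd. \<forall>i. x $ i \<in> S} = card S ^ CARD('d)"
    using assms by (auto simp: card_image card_PiE intro!: finite_PiE)
qed

lemma finite_lattice_box: "finite (lattice_box n :: (int ^ 'd) set)"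
  and card_lattice_box: "card (lattice_box n :: (int ^ 'd) set) =
     nat (2 * \<lfloor>real n powr (1 / real CARD('d)) / 2\<rfloor> + 1) ^ CARD('d)"
proof -
  define r where "r = real n powr (1 / real CARD('d)) / 2"
  have "r \<ge> 0" by (simp add: r_def)
  then have f: "\<lfloor>r\<rfloor> \<ge> 0" by simp
  have "lattice_box n = {x :: int ^ 'd. \<forall>i. x $ i \<in> {- \<lfloor>r\<rfloor> .. \<lfloor>r\<rfloor>}}"
    unfolding lattice_box_def r_def[symmetric]
    by (auto simp: le_floor_iff) (smt (verit) le_floor_iff of_int_minus)+
  then show "finite (lattice_box n :: (int ^ 'd) set)"
    and "card (lattice_box n :: (int ^ 'd) set) =
     nat (2 * \<lfloor>real n powr (1 / real CARD('d)) / 2\<rfloor> + 1) ^ CARD('d)"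
    unfolding r_def[symmetric]
    using card_vec_Collect[of "{- \<lfloor>r\<rfloor> .. \<lfloor>r\<rfloor>}", where 'd='d] f
    by (auto simp: algebra_simps)
qed

lemma eventually_nondegenerate_size:
  assumes "0 < \<rho>" "\<rho> < 1"
  shows "eventually (nondegenerate_size TYPE('d::finite) \<rho>) sequentially"
proof -
  define d where "d = CARD('d)"
  have d: "d > 0" by (simp add: d_def)
  define x where "x n = real n powr (1 / real d)" for n :: nat
  have "(\<lambda>n. real n powr - (1 / real d)) \<longlonglongrightarrow> 0"
    using d by (intro tendsto_neg_powr filterlim_real_sequentially) auto
  then have "(\<lambda>n. inverse (x n)) \<longlonglongrightarrow> 0"
    by (simp add: x_def powr_minus)
  then have "(\<lambda>n. (1 - inverse (x n)) ^ d) \<longlonglongrightarrow> (1 - 0) ^ d"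
    by (intro tendsto_intros)
  then have lim: "eventually (\<lambda>n. \<rho> < (1 - inverse (x n)) ^ d) sequentially"
    using assms by (intro order_tendstoD) auto
  have x1: "eventually (\<lambda>n. x n \<ge> 1) sequentially"
    using eventually_ge_at_top[of 1]
    by eventually_elim (auto simp: x_def intro!: ge_one_powr_ge_zero)
  have n1: "eventually (\<lambda>n. real n \<ge> 1 / \<rho>) sequentially"
    using filterlim_real_sequentially by (simp add: filterlim_at_top)
  show ?thesis
    using lim x1 n1
  proof eventually_elim
    case (elim n)
    have n: "1 \<le> \<rho> * real n"
      using elim(3) assms by (simp add: field_simps)
    then have "real n > 0" using assms by (cases n) auto
    then have xn: "x n ^ d = real n"
      using d by (simp add: x_def powr_realpow[symmetric] powr_powr)
    have "\<rho> * real n < (1 - inverse (x n)) ^ d * x n ^ d"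
      using elim(1) \<open>real n > 0\<close> xn by simp
    also have "\<dots> = (x n - 1) ^ d"
      using elim(2) by (simp add: power_mult_distrib[symmetric] algebra_simps)
    also have "\<dots> \<le> real (nat (2 * \<lfloor>x n / 2\<rfloor> + 1)) ^ d"
      using elim(2) by (intro power_mono) linarith+
    also have "\<dots> = real (card (lattice_box n :: (int ^ 'd) set))"
      by (simp add: card_lattice_box x_def d_def)
    finally show ?case
      using n by (simp add: nondegenerate_size_def)
  qed
qed

end

theory Submission
  imports Defs
begin

text \<open>Cut the box into cubes of side \<open>L\<close>. A component of the box with more than \<open>\<rho> n\<close> vertices consists of
  vertices whose component inside their own cube has size at least \<open>k\<close>, and of at most \<open>(2 N + 1) k\<close>
  further vertices, where \<open>N\<close> is the number of open edges between different cubes. The first number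
  is a sum of independent contributions of the cubes, with mean at most \<open>(\<theta> + \<delta>) n\<close> for large \<open>k\<close>,
  so Hoeffding's inequality applies; by summability of the connection probabilities \<open>N\<close> has mean
  at most \<open>\<epsilon> n\<close> for large \<open>L\<close>, so Chernoff's bound applies. For the lower bound, open all
  nearest-neighbour edges of the box. Both models are instances of translation-invariant percolation
  with a summable kernel that is positive and maximal on nearest neighbours.\<close>

section \<open>Clusters and blocks\<close>

text \<open>Edges of any length may join different cubes, so the cubes are nearly independent only
  because such edges are scarce. Each crossing edge may account for 2k vertices, so the constants
  come in a forced order: k from \<theta>, then \<epsilon> of order 1/k, then L from \<epsilon>, and
  only then large n. A component inside a cube is at most as large as the cluster of its vertex in
  the whole lattice, so the mean count is controlled by the probability that the cluster of the
  origin has at least k vertices, and this tends to \<theta>. The probability space is arbitrary and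
  carries no translations; invariance is obtained by comparing explicit formulas for finite edge
  sets. The exponential bound holds for large n only. For each remaining n the probability must be
  shown to be strictly below one. This is where \<theta> < 1 enters: it forbids probability one on
  nearest neighbours, hence by maximality on every edge, so with positive probability the box has no
  open edge at all.\<close>

lemma cluster_refl [simp]: "x \<in> cluster G x"
  by (simp add: cluster_def)

lemma cluster_step: "y \<in> cluster G x \<Longrightarrow> {y, z} \<in> G \<Longrightarrow> z \<in> cluster G x"
  by (auto simp: cluster_def intro: rtrancl_into_rtrancl)

lemma cluster_trans: "y \<in> cluster G x \<Longrightarrow> z \<in> cluster G y \<Longrightarrow> z \<in> cluster G x"
  by (auto simp: cluster_def)

lemma cluster_induct [consumes 1, case_names refl step]:
  assumes "y \<in> cluster G x"
    and "P x"
    and "\<And>y z. y \<in> cluster G x \<Longrightarrow> {y, z} \<in> G \<Longrightarrow> P y \<Longrightarrow> P z"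
  shows "P y"
proof -
  have "(x, y) \<in> {(u, v). {u, v} \<in> G}\<^sup>*"
    using assms(1) by (simp add: cluster_def)
  then show ?thesis
  proof (induction rule: rtrancl_induct)
    case (step y z)
    then show ?case using assms(3)[of y z] by (simp add: cluster_def)
  qed (rule assms(2))
qed

lemma cluster_sym: "y \<in> cluster G x \<Longrightarrow> x \<in> cluster G y"
proof (induction rule: cluster_induct)
  case (step y z)
  then have "y \<in> cluster G z"
    using cluster_step[OF cluster_refl, of z y G] by (simp add: insert_commute)
  then show ?case using step.IH by (rule cluster_trans)
qed simp

lemma cluster_mono: "G \<subseteq> H \<Longrightarrow> cluster G x \<subseteq> cluster H x"
proof
  fix y assume "G \<subseteq> H" "y \<in> cluster G x"
  from this(2,1) show "y \<in> cluster H x"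
    by (induction rule: cluster_induct) (auto intro: cluster_step)
qed

lemma cluster_empty_edges: "cluster {} x = {x}"
proof -
  have "y = x" if "y \<in> cluster {} x" for y
    using that by (induction rule: cluster_induct) auto
  then show ?thesis by auto
qed

text \<open>A connection uses only the edges of one finite path. This is the source of
  measurability: connection events become countable unions of events about finitely many
  edges.\<close>

lemma cluster_finite_edges:
  assumes "y \<in> cluster G x"
  obtains F where "finite F" "F \<subseteq> G" "y \<in> cluster F x"
proof -
  have "\<exists>F. finite F \<and> F \<subseteq> G \<and> y \<in> cluster F x"
    using assms
  proof (induction rule: cluster_induct)
    case refl
    show ?case by (intro exI[of _ "{}"]) simp
  next
    case (step y z)
    then obtain F where F: "finite F" "F \<subseteq> G" "y \<in> cluster F x" by blast
    then have "z \<in> cluster (insert {y, z} F) x"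
      using cluster_mono[of F "insert {y, z} F" x] by (blast intro: cluster_step)
    with F step show ?case
      by (intro exI[of _ "insert {y, z} F"]) auto
  qed
  then show ?thesis using that by blast
qed

lemma cluster_induced_subset: "x \<in> V \<Longrightarrow> cluster (induced_subgraph G V) x \<subseteq> V"
proof
  fix y assume "x \<in> V" "y \<in> cluster (induced_subgraph G V) x"
  from this(2,1) show "y \<in> V"
    by (induction rule: cluster_induct) (auto simp: induced_subgraph_def)
qed

lemma cluster_image:
  assumes "y \<in> cluster G x"
  shows "f y \<in> cluster ((`) f ` G) (f x)"
  using assms
proof (induction rule: cluster_induct)
  case (step y z)
  then have "f ` {y, z} \<in> (`) f ` G" by (intro imageI)
  then show ?case using cluster_step[OF step.IH, of "f z"] by simp
qed simp

text \<open>Meant for translations of the lattice. Injectivity allows an edge of the image graph to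
  be pulled back to an edge of \<open>G\<close>.\<close>

lemma cluster_image_inj:
  assumes "inj f"
  shows "cluster ((`) f ` G) (f x) = f ` cluster G x"
proof (intro equalityI subsetI)
  fix y assume "y \<in> cluster ((`) f ` G) (f x)"
  then show "y \<in> f ` cluster G x"
  proof (induction rule: cluster_induct)
    case (step y z)
    from step.IH obtain y' where y': "y = f y'" "y' \<in> cluster G x" by (rule imageE)
    from step.hyps(2) obtain e where e: "e \<in> G" "f ` e = {y, z}" by (metis imageE)
    from e(2) have "z \<in> f ` e" by simp
    then obtain z' where z': "z = f z'" by (rule imageE)
    have "f ` e = f ` {y', z'}"
      unfolding e(2) y'(1) z' by simp
    then have "e = {y', z'}"
      using assms by (simp only: inj_image_eq_iff)
    then have "z' \<in> cluster G x"
      using cluster_step[OF y'(2)] e(1) by simp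
    then show ?case unfolding z' by (rule imageI)
  qed simp
qed (auto intro: cluster_image)

text \<open>Follow a path from \<open>x\<close> to \<open>y\<close>: up to its first edge outside
  \<open>H\<close> it stays in the \<open>H\<close>-cluster of \<open>x\<close>, so that edge has an
  endpoint there.\<close>

lemma cluster_subgraph_or_boundary:
  assumes "y \<in> cluster G x"
  shows "y \<in> cluster H x \<or> (\<exists>e\<in>G - H. \<exists>v\<in>e. v \<in> cluster H x)"
  using assms
proof (induction rule: cluster_induct)
  case (step y z)
  then show ?case by (cases "{y, z} \<in> H") (auto intro: cluster_step)
qed simp

text \<open>Each \<open>H\<close>-cluster inside the \<open>G\<close>-cluster of \<open>x\<close>
  contains \<open>x\<close> or an endpoint of a removed edge. There are at most
  \<open>2 * card (G - H) + 1\<close> such vertices, and each lies in one \<open>H\<close>-cluster.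
  Finiteness is demanded in the set because an infinite set has cardinality 0 and would pass as
  small.\<close>

lemma card_small_subclusters_le:
  assumes X: "finite (G - H)" "\<And>e. e \<in> G - H \<Longrightarrow> finite e \<and> card e \<le> 2"
  shows "card {y \<in> cluster G x. finite (cluster H y) \<and> card (cluster H y) < k}
    \<le> (2 * card (G - H) + 1) * k" (is "card ?S \<le> _")
proof -
  let ?I = "insert x (\<Union>(G - H))"
  \<comment> \<open>Vertices with a small \<open>H\<close>-cluster through \<open>v\<close>: there
    are none, or all of them lie in one small cluster.\<close>
  define T where "T v = {y. v \<in> cluster H y \<and> finite (cluster H y) \<and> card (cluster H y) < k}" for v
  have finI: "finite ?I" using X by auto
  have T: "finite (T v) \<and> card (T v) \<le> k" for v
  proof (cases "T v = {}")
    case False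
    then obtain y where y: "v \<in> cluster H y" "finite (cluster H y)" "card (cluster H y) < k"
      by (auto simp: T_def)
    have "T v \<subseteq> cluster H y"
      using y(1) by (auto simp: T_def intro: cluster_sym cluster_trans)
    with y show ?thesis
      by (meson card_mono finite_subset le_trans less_imp_le)
  qed simp
  have "?S \<subseteq> (\<Union>v\<in>?I. T v)"
  proof
    fix y assume y: "y \<in> ?S"
    \<comment> \<open>The path is read from \<open>y\<close> towards \<open>x\<close>, so that the
      boundary vertex it meets lies in the \<open>H\<close>-cluster of \<open>y\<close>.\<close>
    then have "x \<in> cluster G y" by (auto intro: cluster_sym)
    from cluster_subgraph_or_boundary[OF this, of H] y show "y \<in> (\<Union>v\<in>?I. T v)"
      by (auto simp: T_def)
  qed
  then have "card ?S \<le> card (\<Union>v\<in>?I. T v)"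
    using finI T by (intro card_mono finite_UN_I) blast+
  also have "\<dots> \<le> (\<Sum>v\<in>?I. card (T v))"
    using finI by (rule card_UN_le)
  also have "\<dots> \<le> (\<Sum>v\<in>?I. k)"
    using T by (intro sum_mono) auto
  also have "\<dots> = card ?I * k" by simp
  also have "card (\<Union>(G - H)) \<le> (\<Sum>e\<in>G - H. 2)"
    using X by (intro order_trans[OF card_Union_le_sum_card_weak] sum_mono) auto
  then have "card ?I \<le> 2 * card (G - H) + 1"
    using finI card_insert_le_m1 by (simp add: card_insert_if mult.commute)
  finally show ?thesis by simp
qed

lemma vertex_pairs_card: "e \<in> vertex_pairs \<Longrightarrow> finite e \<and> card e = 2"
  by (auto simp: vertex_pairs_def)

text \<open>The labelling \<open>b\<close> assigns each vertex its block. All possible pairs are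
  collected, not only open edges, so the set is deterministic and the number of open edges in it is
  a sum over fixed pairs.\<close>

definition crossing_pairs :: "('v \<Rightarrow> 'u) \<Rightarrow> 'v set \<Rightarrow> 'v set set" where
  "crossing_pairs b V = {e \<in> vertex_pairs. e \<subseteq> V \<and> (\<nexists>u. e \<subseteq> b -` {u})}"

text \<open>Components are taken inside \<open>V\<close>, so the count depends only on edges inside
  \<open>V\<close>; this makes the counts of disjoint blocks independent.\<close>

definition block_count :: "nat \<Rightarrow> 'v set set \<Rightarrow> 'v set \<Rightarrow> nat" where
  "block_count k G V = card {y \<in> V. k \<le> card (cluster (induced_subgraph G V) y)}"

text \<open>Delete the crossing edges. Vertices left in components smaller than \<open>k\<close> are
  bounded by \<open>card_small_subclusters_le\<close>; every other vertex has at least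
  \<open>k\<close> vertices in its component within its own block.\<close>

lemma card_cluster_le_blocks:
  assumes G: "G \<subseteq> vertex_pairs"
    and V: "finite V" "x \<in> V"
    and U: "b ` V \<subseteq> U" "finite U" "\<And>u. u \<in> U \<Longrightarrow> finite (b -` {u})"
  shows "card (cluster (induced_subgraph G V) x)
    \<le> (\<Sum>u\<in>U. block_count k G (b -` {u})) + (2 * card (G \<inter> crossing_pairs b V) + 1) * k"
proof -
  define G' where "G' = induced_subgraph G V"
  define H where "H = {e \<in> G'. \<exists>u. e \<subseteq> b -` {u}}"
  have X: "G' - H = G \<inter> crossing_pairs b V"
    using G by (auto simp: H_def G'_def induced_subgraph_def crossing_pairs_def)
  have "G' - H \<subseteq> Pow V" by (auto simp: G'_def induced_subgraph_def)
  then have finX: "finite (G' - H)" using V(1) by (simp add: finite_subset)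
  have card2: "finite e \<and> card e \<le> 2" if "e \<in> G' - H" for e
  proof -
    have "e \<in> vertex_pairs" using that G by (auto simp: G'_def induced_subgraph_def)
    then show ?thesis using vertex_pairs_card by fastforce
  qed
  let ?C = "cluster G' x"
  let ?S = "{y \<in> ?C. finite (cluster H y) \<and> card (cluster H y) < k}"
  \<comment> \<open>The full block is used even where it sticks out of \<open>V\<close>. This can
    only enlarge the components, and it allows all blocks to be treated alike.\<close>
  let ?B = "\<lambda>u. {y \<in> b -` {u}. k \<le> card (cluster (induced_subgraph G (b -` {u})) y)}"
  have CV: "?C \<subseteq> V" unfolding G'_def using V(2) by (rule cluster_induced_subset)
  have sub: "?C \<subseteq> ?S \<union> (\<Union>u\<in>U. ?B u)"
  proof
    fix y assume y: "y \<in> ?C"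
    then have yU: "b y \<in> U" "y \<in> b -` {b y}" using CV U(1) by auto
    let ?K = "cluster (induced_subgraph G (b -` {b y})) y"
    have "cluster H y \<subseteq> ?K"
    proof
      fix z assume "z \<in> cluster H y"
      then show "z \<in> ?K"
      proof (induction rule: cluster_induct)
        case (step z w)
        then have "z \<in> b -` {b y}"
          using cluster_induced_subset[OF yU(2)] by blast
        then have "{z, w} \<in> induced_subgraph G (b -` {b y})"
          using step(2) by (auto simp: H_def G'_def induced_subgraph_def)
        with step show ?case by (blast intro: cluster_step)
      qed simp
    qed
    moreover have "finite ?K"
      using cluster_induced_subset[OF yU(2)] U(3)[OF yU(1)] by (rule finite_subset)
    ultimately have "finite (cluster H y)" "card (cluster H y) \<le> card ?K"
      by (auto intro: finite_subset card_mono)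
    with y yU show "y \<in> ?S \<union> (\<Union>u\<in>U. ?B u)"
      by (cases "card (cluster H y) < k") auto
  qed
  have "finite (?B u)" if "u \<in> U" for u
    using U(3)[OF that] by (rule rev_finite_subset) blast
  then have "finite (?S \<union> (\<Union>u\<in>U. ?B u))"
    using U(2) finite_subset[OF CV V(1)] by simp
  then have "card ?C \<le> card (?S \<union> (\<Union>u\<in>U. ?B u))"
    using sub by (intro card_mono)
  also have "\<dots> \<le> card ?S + card (\<Union>u\<in>U. ?B u)" by (rule card_Un_le)
  also have "card (\<Union>u\<in>U. ?B u) \<le> (\<Sum>u\<in>U. card (?B u))"
    using U(2) by (rule card_UN_le)
  also have "card ?S \<le> (2 * card (G' - H) + 1) * k"
    using finX card2 by (rule card_small_subclusters_le)
  finally show ?thesis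
    unfolding X by (simp add: G'_def block_count_def)
qed

section \<open>Edge configurations\<close>

text \<open>Expresses that the cluster has at least \<open>k\<close> vertices. A comparison with
  \<open>card\<close> would fail for infinite clusters, whose cardinality is 0 by
  convention.\<close>

definition has_cluster :: "nat \<Rightarrow> 'v set set \<Rightarrow> 'v \<Rightarrow> bool" where
  "has_cluster k G x \<longleftrightarrow> (\<exists>T\<subseteq>cluster G x. finite T \<and> card T = k)"

lemma has_cluster_mono: "G \<subseteq> H \<Longrightarrow> has_cluster k G x \<Longrightarrow> has_cluster k H x"
  unfolding has_cluster_def using cluster_mono[of G H x] by blast

lemma has_cluster_antimono: "has_cluster k G x \<Longrightarrow> j \<le> k \<Longrightarrow> has_cluster j G x"
  unfolding has_cluster_def
  by (metis finite_subset obtain_subset_with_card_n order_trans)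

lemma has_cluster_finite:
  "finite (cluster G x) \<Longrightarrow> has_cluster k G x \<longleftrightarrow> k \<le> card (cluster G x)"
  unfolding has_cluster_def
  by (metis card_mono finite_subset obtain_subset_with_card_n)

lemma infinite_cluster_iff: "infinite (cluster G x) \<longleftrightarrow> (\<forall>k. has_cluster k G x)"
proof
  assume inf: "infinite (cluster G x)"
  show "\<forall>k. has_cluster k G x"
  proof
    fix k
    show "has_cluster k G x"
      using infinite_arbitrarily_large[OF inf, of k] unfolding has_cluster_def by blast
  qed
next
  assume "\<forall>k. has_cluster k G x"
  then have *: "has_cluster (Suc (card (cluster G x))) G x" ..
  show "infinite (cluster G x)"
    using * has_cluster_finite[of G x "Suc (card (cluster G x))"] not_less_eq_eq by blast
qed

lemma has_cluster_finite_edges: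
  assumes "has_cluster k G x"
  shows "\<exists>F\<subseteq>G. finite F \<and> has_cluster k F x"
proof -
  obtain T where T: "T \<subseteq> cluster G x" "finite T" "card T = k"
    using assms by (auto simp: has_cluster_def)
  have "\<exists>F. finite F \<and> F \<subseteq> G \<and> y \<in> cluster F x" if "y \<in> T" for y
  proof -
    have "y \<in> cluster G x" using T(1) that by auto
    then obtain F where "finite F" "F \<subseteq> G" "y \<in> cluster F x" by (rule cluster_finite_edges)
    then show ?thesis by blast
  qed
  then obtain F where F: "\<And>y. y \<in> T \<Longrightarrow> finite (F y) \<and> F y \<subseteq> G \<and> y \<in> cluster (F y) x"
    by metis
  have "T \<subseteq> cluster (\<Union>y\<in>T. F y) x"
  proof
    fix y assume y: "y \<in> T"
    then have "cluster (F y) x \<subseteq> cluster (\<Union>y\<in>T. F y) x"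
      by (intro cluster_mono) auto
    with F[OF y] show "y \<in> cluster (\<Union>y\<in>T. F y) x" by blast
  qed
  with T F show ?thesis
    unfolding has_cluster_def by (intro exI[of _ "\<Union>y\<in>T. F y"]) auto
qed

lemma countable_vertex_pairs: "countable (vertex_pairs :: 'v::countable set set)"
proof -
  have "vertex_pairs \<subseteq> range (\<lambda>(x, y). {x, y :: 'v})"
    by (auto simp: vertex_pairs_def)
  then show ?thesis by (rule countable_subset) simp
qed

lemma finite_pairs_in: "finite V \<Longrightarrow> finite {e \<in> vertex_pairs. e \<subseteq> V}"
  by (rule finite_subset[of _ "Pow V"]) auto

section \<open>Finite edge configurations: measurability and explicit probabilities\<close>

context bond_percolation
begin

text \<open>An edge is unordered while \<open>\<kappa>\<close> takes an ordered pair; defining the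
  value through the event avoids choosing an orientation.\<close>

definition edge_pr :: "(int ^ 'd) set \<Rightarrow> real" where
  "edge_pr e = prob {\<omega> \<in> space M. e \<in> E \<omega>}"

lemma edge_pr_nonneg: "0 \<le> edge_pr e" and edge_pr_le_1: "edge_pr e \<le> 1"
  by (simp_all add: edge_pr_def)

lemma edge_pr: "x \<noteq> y \<Longrightarrow> edge_pr {x, y} = \<kappa> x y"
  by (simp add: edge_pr_def edge_prob)

lemma edge_event: "e \<in> vertex_pairs \<Longrightarrow> {\<omega> \<in> space M. e \<in> E \<omega>} \<in> events"
  using edges_indep by (auto simp: indep_events_def)

lemma edges_event:
  assumes "finite F" "F \<subseteq> vertex_pairs"
  shows "{\<omega> \<in> space M. F \<subseteq> E \<omega>} \<in> events"
proof -
  have "{\<omega> \<in> space M. \<forall>e\<in>F. e \<in> E \<omega>} \<in> events"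
    using assms edge_event by (intro sets.sets_Collect_finite_All) auto
  then show ?thesis by (simp add: subset_eq)
qed

lemma prob_edges:
  assumes "finite F" "F \<subseteq> vertex_pairs"
  shows "prob {\<omega> \<in> space M. F \<subseteq> E \<omega>} = (\<Prod>e\<in>F. edge_pr e)"
proof (cases "F = {}")
  case False
  then have "prob (\<Inter>e\<in>F. {\<omega> \<in> space M. e \<in> E \<omega>}) = (\<Prod>e\<in>F. edge_pr e)"
    using edges_indep assms by (auto simp: indep_events_def edge_pr_def)
  moreover have "(\<Inter>e\<in>F. {\<omega> \<in> space M. e \<in> E \<omega>}) = {\<omega> \<in> space M. F \<subseteq> E \<omega>}"
    using False by auto
  ultimately show ?thesis by simp
qed (simp add: prob_space)

text \<open>\<open>indep_events\<close> speaks of open edges only. Passing to the generated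
  \<sigma>-algebras covers closed edges too, as configurations and Hoeffding's inequality
  require.\<close>

lemma indep_vars_edges: "indep_vars (\<lambda>_. count_space UNIV) (\<lambda>e \<omega>. e \<in> E \<omega>) vertex_pairs"
proof -
  have "indep_sets (\<lambda>e. sigma_sets (space M) {{\<omega> \<in> space M. e \<in> E \<omega>}}) vertex_pairs"
    using edges_indep unfolding indep_events_def_alt
    by (intro indep_sets_sigma) (auto simp: Int_stable_def)
  moreover have "{(\<lambda>\<omega>. e \<in> E \<omega>) -` A \<inter> space M |A. A \<in> sets (count_space UNIV)}
      \<subseteq> sigma_sets (space M) {{\<omega> \<in> space M. e \<in> E \<omega>}}" for e
  proof safe
    fix A :: "bool set"
    let ?T = "{\<omega> \<in> space M. e \<in> E \<omega>}"
    have eq: "(\<lambda>\<omega>. e \<in> E \<omega>) -` A \<inter> space M =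
        (if True \<in> A then if False \<in> A then space M else ?T
         else if False \<in> A then space M - ?T else {})"
    proof -
      have "\<omega> \<in> (\<lambda>\<omega>. e \<in> E \<omega>) -` A \<inter> space M \<longleftrightarrow> \<omega> \<in> (if True \<in> A then if False \<in> A then space M else ?T
         else if False \<in> A then space M - ?T else {})" for \<omega>
        by (cases "e \<in> E \<omega>") simp_all
      then show ?thesis by blast
    qed
    show "(\<lambda>\<omega>. e \<in> E \<omega>) -` A \<inter> space M \<in> sigma_sets (space M) {?T}"
      unfolding eq by (auto intro: sigma_sets.intros sigma_sets_top)
  qed
  ultimately have "indep_sets (\<lambda>e. {(\<lambda>\<omega>. e \<in> E \<omega>) -` A \<inter> space M |A. A \<in> sets (count_space UNIV)})
      vertex_pairs"
    by (rule indep_sets_mono_sets)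
  then show ?thesis
    unfolding indep_vars_def2 using edge_event
    by (auto simp: measurable_count_space_eq2 measurable_count_space_eq_countable pred_def)
qed

lemma prob_config:
  assumes K: "finite K" "K \<subseteq> vertex_pairs" and F: "F \<subseteq> K"
  shows "prob {\<omega> \<in> space M. E \<omega> \<inter> K = F} = (\<Prod>e\<in>K. if e \<in> F then edge_pr e else 1 - edge_pr e)"
proof (cases "K = {}")
  case True
  with F show ?thesis by (simp add: prob_space)
next
  case False
  have "prob (\<Inter>e\<in>K. (\<lambda>\<omega>. e \<in> E \<omega>) -` {e \<in> F} \<inter> space M)
      = (\<Prod>e\<in>K. prob ((\<lambda>\<omega>. e \<in> E \<omega>) -` {e \<in> F} \<inter> space M))"
    using K False by (intro indep_varsD[OF indep_vars_edges]) auto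
  also have "(\<Inter>e\<in>K. (\<lambda>\<omega>. e \<in> E \<omega>) -` {e \<in> F} \<inter> space M) = {\<omega> \<in> space M. E \<omega> \<inter> K = F}"
    using False F by auto
  also have "(\<Prod>e\<in>K. prob ((\<lambda>\<omega>. e \<in> E \<omega>) -` {e \<in> F} \<inter> space M))
      = (\<Prod>e\<in>K. if e \<in> F then edge_pr e else 1 - edge_pr e)"
  proof (rule prod.cong)
    fix e assume "e \<in> K"
    with K have ev: "{\<omega> \<in> space M. e \<in> E \<omega>} \<in> events" by (auto intro: edge_event)
    have "(\<lambda>\<omega>. e \<in> E \<omega>) -` {False} \<inter> space M = space M - {\<omega> \<in> space M. e \<in> E \<omega>}"
      "(\<lambda>\<omega>. e \<in> E \<omega>) -` {True} \<inter> space M = {\<omega> \<in> space M. e \<in> E \<omega>}"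
      by auto
    with prob_compl[OF ev] show "prob ((\<lambda>\<omega>. e \<in> E \<omega>) -` {e \<in> F} \<inter> space M)
        = (if e \<in> F then edge_pr e else 1 - edge_pr e)"
      by (cases "e \<in> F") (simp_all add: edge_pr_def)
  qed simp
  finally show ?thesis .
qed

lemma config_event:
  assumes "finite K" "K \<subseteq> vertex_pairs"
  shows "{\<omega> \<in> space M. \<Phi> (E \<omega> \<inter> K)} \<in> events"
proof -
  have *: "{\<omega> \<in> space M. E \<omega> \<inter> K = F} \<in> events" if "F \<subseteq> K" for F
  proof -
    have "{\<omega> \<in> space M. \<forall>e\<in>K. (e \<in> E \<omega>) = (e \<in> F)} \<in> events"
    proof (intro sets.sets_Collect_finite_All ballI)
      fix e assume "e \<in> K"
      then have "{\<omega> \<in> space M. e \<in> E \<omega>} \<in> events" using assms edge_event by auto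
      from this sets.sets_Collect_neg[OF this] show "{\<omega> \<in> space M. (e \<in> E \<omega>) = (e \<in> F)} \<in> events"
        by (cases "e \<in> F") auto
    qed (use assms in auto)
    also have "{\<omega> \<in> space M. \<forall>e\<in>K. (e \<in> E \<omega>) = (e \<in> F)} = {\<omega> \<in> space M. E \<omega> \<inter> K = F}"
      using that by auto
    finally show ?thesis .
  qed
  have "{\<omega> \<in> space M. \<Phi> (E \<omega> \<inter> K)} = (\<Union>F\<in>{F \<in> Pow K. \<Phi> F}. {\<omega> \<in> space M. E \<omega> \<inter> K = F})"
    by auto
  also have "\<dots> \<in> events"
    using assms * by (intro sets.finite_UN) auto
  finally show ?thesis .
qed

text \<open>The probability is an explicit finite sum in the edge probabilities alone. Translated
  events can therefore be compared by reindexing this sum, without any transformation of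
  \<open>M\<close>.\<close>

lemma prob_config_pred:
  assumes K: "finite K" "K \<subseteq> vertex_pairs"
  shows "prob {\<omega> \<in> space M. \<Phi> (E \<omega> \<inter> K)}
    = (\<Sum>F\<in>{F \<in> Pow K. \<Phi> F}. \<Prod>e\<in>K. if e \<in> F then edge_pr e else 1 - edge_pr e)"
proof -
  have "{\<omega> \<in> space M. \<Phi> (E \<omega> \<inter> K)} = (\<Union>F\<in>{F \<in> Pow K. \<Phi> F}. {\<omega> \<in> space M. E \<omega> \<inter> K = F})"
    by auto
  moreover have "prob (\<Union>F\<in>{F \<in> Pow K. \<Phi> F}. {\<omega> \<in> space M. E \<omega> \<inter> K = F})
      = (\<Sum>F\<in>{F \<in> Pow K. \<Phi> F}. prob {\<omega> \<in> space M. E \<omega> \<inter> K = F})"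
    using K config_event[OF K, of "\<lambda>G. G = _"]
    by (intro finite_measure_finite_Union) (auto simp: disjoint_family_on_def)
  ultimately show ?thesis
    using prob_config[OF K] by simp
qed

text \<open>An increasing property with finite witnesses is the union, over the countably many
  finite edge sets \<open>F\<close> with the property, of the events that all of \<open>F\<close> is
  open.\<close>

lemma monotone_event:
  assumes mono: "\<And>F G. F \<subseteq> G \<Longrightarrow> \<Phi> F \<Longrightarrow> \<Phi> G"
    and fin: "\<And>G. \<Phi> G \<Longrightarrow> \<exists>F\<subseteq>G. finite F \<and> \<Phi> F"
  shows "{\<omega> \<in> space M. \<Phi> (E \<omega>)} \<in> events"
proof -
  let ?\<F> = "{F. F \<subseteq> vertex_pairs \<and> finite F \<and> \<Phi> F}"
  have "{F :: (int ^ 'd) set set. finite F \<and> F \<subseteq> vertex_pairs} = {F. F \<subseteq> vertex_pairs \<and> finite F}"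
    by auto
  then have "countable {F :: (int ^ 'd) set set. F \<subseteq> vertex_pairs \<and> finite F}"
    using countable_Collect_finite_subset[OF countable_vertex_pairs] by metis
  then have "countable ?\<F>"
    by (rule countable_subset[rotated]) auto
  then have "(\<Union>F\<in>?\<F>. {\<omega> \<in> space M. F \<subseteq> E \<omega>}) \<in> events"
    using edges_event by (intro sets.countable_UN') auto
  also have "(\<Union>F\<in>?\<F>. {\<omega> \<in> space M. F \<subseteq> E \<omega>}) = {\<omega> \<in> space M. \<Phi> (E \<omega>)}"
  proof (intro equalityI subsetI)
    fix \<omega> assume \<omega>: "\<omega> \<in> {\<omega> \<in> space M. \<Phi> (E \<omega>)}"
    then obtain F where "F \<subseteq> E \<omega>" "finite F" "\<Phi> F" using fin by blast
    moreover have "E \<omega> \<subseteq> vertex_pairs" using \<omega> edges by auto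
    ultimately show "\<omega> \<in> (\<Union>F\<in>?\<F>. {\<omega> \<in> space M. F \<subseteq> E \<omega>})" using \<omega> by blast
  qed (use mono in blast)
  finally show ?thesis .
qed

lemma has_cluster_event: "{\<omega> \<in> space M. has_cluster k (E \<omega>) x} \<in> events"
  by (rule monotone_event) (fact has_cluster_mono has_cluster_finite_edges)+

text \<open>Continuity from above along decreasing events. With \<open>x = 0\<close> the limit is
  \<theta>, which is how \<theta> enters the choice of \<open>k\<close>.\<close>

lemma has_cluster_prob_tendsto:
  "(\<lambda>k. prob {\<omega> \<in> space M. has_cluster k (E \<omega>) x})
    \<longlonglongrightarrow> prob {\<omega> \<in> space M. infinite (cluster (E \<omega>) x)}"
proof -
  have "(\<lambda>k. prob {\<omega> \<in> space M. has_cluster k (E \<omega>) x})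
      \<longlonglongrightarrow> prob (\<Inter>k. {\<omega> \<in> space M. has_cluster k (E \<omega>) x})"
    using has_cluster_event
    by (intro finite_Lim_measure_decseq) (auto simp: decseq_def intro: has_cluster_antimono)
  also have "(\<Inter>k. {\<omega> \<in> space M. has_cluster k (E \<omega>) x}) = {\<omega> \<in> space M. infinite (cluster (E \<omega>) x)}"
    by (auto simp: infinite_cluster_iff)
  finally show ?thesis .
qed

lemma infinite_cluster_event: "{\<omega> \<in> space M. infinite (cluster (E \<omega>) x)} \<in> events"
proof -
  have "{\<omega> \<in> space M. infinite (cluster (E \<omega>) x)} = (\<Inter>k. {\<omega> \<in> space M. has_cluster k (E \<omega>) x})"
    by (auto simp: infinite_cluster_iff)
  then show ?thesis using has_cluster_event by auto
qed

text \<open>Markov's inequality for \<open>2 ^ N\<close>, where \<open>N\<close> is the number of open edges in \<open>K\<close>: \<open>2 ^ N\<close> counts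
  the sets of open edges in \<open>K\<close>, so its mean is the product of all \<open>1 + edge_pr e\<close>.\<close>

lemma prob_many_edges_le:
  assumes K: "finite K" "K \<subseteq> vertex_pairs"
  shows "prob {\<omega> \<in> space M. t \<le> real (card (E \<omega> \<inter> K))} \<le> exp ((\<Sum>e\<in>K. edge_pr e) - t * ln 2)"
proof -
  let ?f = "\<lambda>\<omega>. \<Sum>F\<in>Pow K. indicator {\<omega> \<in> space M. F \<subseteq> E \<omega>} \<omega> :: real"
  have ev: "{\<omega> \<in> space M. F \<subseteq> E \<omega>} \<in> events" if "F \<in> Pow K" for F
    using that K by (intro edges_event) (auto intro: finite_subset)
  have f: "?f \<omega> = 2 ^ card (E \<omega> \<inter> K)" if "\<omega> \<in> space M" for \<omega>
  proof -
    have "?f \<omega> = (\<Sum>F\<in>Pow (E \<omega> \<inter> K). 1)"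
      using that K by (intro sum.mono_neutral_cong_right) (auto simp: indicator_def)
    then show ?thesis using K by (simp add: card_Pow del: Pow_Int_eq)
  qed
  have int: "integrable M ?f"
    using ev by (intro Bochner_Integration.integrable_sum integrable_real_indicator)
      (auto simp: less_top[symmetric])
  have "expectation ?f = (\<Sum>F\<in>Pow K. prob {\<omega> \<in> space M. F \<subseteq> E \<omega>})"
    using ev by (subst Bochner_Integration.integral_sum)
      (auto simp: less_top[symmetric] intro!: integrable_real_indicator sum.cong)
  \<comment> \<open>The factors 1 bring the sum into the shape of the expanded product of all
    \<open>edge_pr e + 1\<close>.\<close>
  also have "\<dots> = (\<Sum>F\<in>Pow K. (\<Prod>e\<in>F. edge_pr e) * (\<Prod>e\<in>K - F. 1))"
    using K by (intro sum.cong) (auto intro!: prob_edges intro: finite_subset)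
  also have "\<dots> = (\<Prod>e\<in>K. edge_pr e + 1)"
    using K(1) by (rule prod_add[symmetric])
  also have "\<dots> \<le> (\<Prod>e\<in>K. exp (edge_pr e))"
    by (intro prod_mono) (auto simp: edge_pr_nonneg add.commute exp_ge_add_one_self)
  also have "\<dots> = exp (\<Sum>e\<in>K. edge_pr e)"
    using K(1) by (simp add: exp_sum)
  finally have mean: "expectation ?f \<le> exp (\<Sum>e\<in>K. edge_pr e)" .
  have "{\<omega> \<in> space M. t \<le> real (card (E \<omega> \<inter> K))} = {\<omega> \<in> space M. 2 powr t \<le> ?f \<omega>}"
    using f by (auto simp: powr_realpow[symmetric])
  also have "prob \<dots> \<le> expectation ?f / 2 powr t"
    using f int by (intro integral_Markov_inequality_measure[where A = "{}"]) (auto intro!: sum_nonneg)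
  also have "\<dots> \<le> exp (\<Sum>e\<in>K. edge_pr e) / 2 powr t"
    using mean by (intro divide_right_mono) auto
  also have "\<dots> = exp ((\<Sum>e\<in>K. edge_pr e) - t * ln 2)"
    by (simp add: powr_def exp_diff mult.commute)
  finally show ?thesis .
qed

section \<open>Concentration for sums over disjoint edge sets\<close>

lemma config_measurable:
  assumes "finite K" "K \<subseteq> vertex_pairs"
  shows "(\<lambda>\<omega>. h (E \<omega> \<inter> K) :: real) \<in> borel_measurable M"
  unfolding borel_measurable_iff_le using config_event[OF assms] by auto

text \<open>The summands read disjoint sets of edges, hence are independent with range [0, c]. Since
  \<open>m\<close> only bounds the mean from above, the event is first enlarged to a deviation from
  the true mean.\<close>

lemma prob_block_sum_ge:
  fixes h :: "'u \<Rightarrow> (int ^ 'd) set set \<Rightarrow> real" and c m s :: real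
  assumes U: "finite U" "U \<noteq> {}"
    and K: "\<And>u. u \<in> U \<Longrightarrow> finite (K u) \<and> K u \<subseteq> vertex_pairs" "disjoint_family_on K U"
    and h: "\<And>u F. u \<in> U \<Longrightarrow> 0 \<le> h u F \<and> h u F \<le> c"
    and c: "c > 0"
    and mean: "(\<Sum>u\<in>U. expectation (\<lambda>\<omega>. h u (E \<omega> \<inter> K u))) \<le> m"
    and s: "s \<ge> 0"
  shows "prob {\<omega> \<in> space M. m + s \<le> (\<Sum>u\<in>U. h u (E \<omega> \<inter> K u))} \<le> exp (- 2 * s\<^sup>2 / (card U * c\<^sup>2))"
proof -
  have "indep_vars (\<lambda>u. PiM (K u) (\<lambda>_. count_space UNIV))
      (\<lambda>u \<omega>. restrict (\<lambda>e. e \<in> E \<omega>) (K u)) U"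
    using K by (intro indep_vars_restrict[OF indep_vars_edges]) auto
  \<comment> \<open>Each summand is a function on a finite product of discrete spaces, where every
    function is measurable.\<close>
  then have "indep_vars (\<lambda>_. borel) (\<lambda>u \<omega>. (\<lambda>\<phi>. h u {e \<in> K u. \<phi> e}) (restrict (\<lambda>e. e \<in> E \<omega>) (K u))) U"
  proof (rule indep_vars_compose2)
    fix u assume "u \<in> U"
    then show "(\<lambda>\<phi>. h u {e \<in> K u. \<phi> e}) \<in> borel_measurable (PiM (K u) (\<lambda>_. count_space UNIV))"
      using K by (subst count_space_PiM_finite) auto
  qed
  moreover have "{e \<in> K u. restrict (\<lambda>e. e \<in> E \<omega>) (K u) e} = E \<omega> \<inter> K u" for u \<omega>
    by auto
  ultimately have indep: "indep_vars (\<lambda>_. borel) (\<lambda>u \<omega>. h u (E \<omega> \<inter> K u)) U"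
    by simp
  interpret Hoeffding_ineq M U "\<lambda>u \<omega>. h u (E \<omega> \<inter> K u)" "\<lambda>_. 0" "\<lambda>_. c"
      "\<Sum>u\<in>U. expectation (\<lambda>\<omega>. h u (E \<omega> \<inter> K u))"
    using U h indep by unfold_locales auto
  let ?\<mu> = "\<Sum>u\<in>U. expectation (\<lambda>\<omega>. h u (E \<omega> \<inter> K u))"
  have "(\<lambda>\<omega>. \<Sum>u\<in>U. h u (E \<omega> \<inter> K u)) \<in> borel_measurable M"
    using K config_measurable by (intro borel_measurable_sum) auto
  then have "{\<omega> \<in> space M. ?\<mu> + s \<le> (\<Sum>u\<in>U. h u (E \<omega> \<inter> K u))} \<in> events"
    by (simp add: borel_measurable_iff_ge)
  then have "prob {\<omega> \<in> space M. m + s \<le> (\<Sum>u\<in>U. h u (E \<omega> \<inter> K u))}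
      \<le> prob {\<omega> \<in> space M. ?\<mu> + s \<le> (\<Sum>u\<in>U. h u (E \<omega> \<inter> K u))}"
    using mean by (intro finite_measure_mono) auto
  also have "\<dots> \<le> exp (- 2 * s\<^sup>2 / (\<Sum>u\<in>U. (c - 0)\<^sup>2))"
    using U s c by (intro Hoeffding_ineq_ge) (auto simp: card_gt_0_iff)
  finally show ?thesis by simp
qed

end

section \<open>Translation-invariant percolation with a summable kernel\<close>

lemma induced_subgraph_eq:
  "G \<subseteq> vertex_pairs \<Longrightarrow> induced_subgraph G V = G \<inter> {e \<in> vertex_pairs. e \<subseteq> V}"
  by (auto simp: induced_subgraph_def)

lemma block_count_restrict:
  "G \<subseteq> vertex_pairs \<Longrightarrow> block_count k (G \<inter> {e \<in> vertex_pairs. e \<subseteq> V}) V = block_count k G V"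
  by (simp add: block_count_def induced_subgraph_eq Int_assoc inf.coboundedI1)

lemma vertex_pairs_translate:
  "{e \<in> vertex_pairs. e \<subseteq> (\<lambda>w. w + a) ` W}
    = (`) (\<lambda>w. w + a :: 'a::group_add) ` {e \<in> vertex_pairs. e \<subseteq> W}" (is "?L = ?R")
proof (intro equalityI subsetI)
  fix e assume e: "e \<in> ?L"
  then obtain x y where "e = {x, y}" "x \<noteq> y" by (auto simp: vertex_pairs_def)
  with e obtain x' y' where "x' \<in> W" "y' \<in> W" "x' \<noteq> y'" "e = (\<lambda>w. w + a) ` {x', y'}"
    by auto
  then show "e \<in> ?R" by (intro image_eqI[of _ _ "{x', y'}"]) (auto simp: vertex_pairs_def)
next
  fix e assume "e \<in> ?R"
  then obtain e' where e': "e = (\<lambda>w. w + a) ` e'" "e' \<in> vertex_pairs" "e' \<subseteq> W" by auto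
  from e'(2) obtain x y where "e' = {x, y}" "x \<noteq> y" by (auto simp: vertex_pairs_def)
  with e'(1) have "e = {x + a, y + a}" "x + a \<noteq> y + a" by auto
  then have "e \<in> vertex_pairs" unfolding vertex_pairs_def by blast
  with e' show "e \<in> ?L" by blast
qed

section \<open>Cubes of side \<open>L\<close> and their interiors\<close>

definition cube :: "int \<Rightarrow> int \<Rightarrow> (int ^ 'd) set" where
  "cube a b = {x. \<forall>i. x $ i \<in> {a..<b}}"

lemma finite_cube: "finite (cube a b :: (int ^ 'd) set)"
  and card_cube: "card (cube a b :: (int ^ 'd) set) = nat (b - a) ^ CARD('d)"
  using card_vec_Collect[of "{a..<b}", where 'd = 'd] by (simp_all add: cube_def)

definition block_index :: "int \<Rightarrow> int ^ 'd \<Rightarrow> int ^ 'd" where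
  "block_index L x = (\<chi> i. x $ i div L)"

text \<open>The residues modulo \<open>L\<close> are the position inside the block; as
  \<open>div\<close> rounds down, this works equally for negative coordinates. The parameter
  \<open>R\<close> cuts off a layer along the faces, and \<open>R = 0\<close> gives the whole
  block.\<close>

lemma block_eq:
  assumes "0 < L" "0 \<le> R"
  shows "{x \<in> block_index L -` {u}. \<forall>i. x $ i mod L \<in> {R..<L - R}}
    = (\<lambda>y. y + (\<chi> i. L * u $ i)) ` cube R (L - R)" (is "?L = ?f ` ?C")
proof (intro equalityI subsetI)
  fix x assume x: "x \<in> ?L"
  have "u = block_index L x" using x by simp
  then have "x = ?f (\<chi> i. x $ i mod L)"
    by (simp add: vec_eq_iff block_index_def)
  moreover have "(\<chi> i. x $ i mod L) \<in> ?C"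
    using x by (simp add: cube_def)
  ultimately show "x \<in> ?f ` ?C" by blast
next
  fix x assume "x \<in> ?f ` ?C"
  then obtain y where y: "x = ?f y" "\<And>i. R \<le> y $ i \<and> y $ i < L - R"
    by (auto simp: cube_def)
  have y0: "0 \<le> y $ i \<and> y $ i < L" for i
    using y(2)[of i] assms by linarith
  have "x $ i div L = u $ i \<and> x $ i mod L = y $ i" for i
    using y0[of i] assms by (simp add: y(1))
  then show "x \<in> ?L"
    using y(2) by (auto simp: block_index_def vec_eq_iff)
qed

lemma card_block_interior:
  assumes "0 < L" "0 \<le> R"
  shows "card {x \<in> block_index L -` {u :: int ^ 'd}. \<forall>i. x $ i mod L \<in> {R..<L - R}}
    = nat (L - 2 * R) ^ CARD('d)"
  unfolding block_eq[OF assms] by (subst card_image) (auto simp: card_cube algebra_simps)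

lemma block_eq_image:
  "0 < L \<Longrightarrow> block_index L -` {u} = (\<lambda>y. y + (\<chi> i. L * u $ i)) ` cube 0 L"
  using block_eq[of L 0 u] by (simp add: vimage_def)

lemma finite_block: "0 < L \<Longrightarrow> finite (block_index L -` {u})"
  by (simp add: block_eq_image finite_cube)

lemma card_block: "0 < L \<Longrightarrow> card (block_index L -` {u :: int ^ 'd}) = nat L ^ CARD('d)"
  using card_block_interior[of L 0 u] by (simp add: vimage_def)

text \<open>A residue at least \<open>R\<close> away from both ends stays between 0 and
  \<open>L\<close> after a shift by at most \<open>R\<close>.\<close>

lemma block_index_add:
  assumes "0 < L" "\<And>i. x $ i mod L \<in> {R..<L - R}" "\<And>i. \<bar>z $ i\<bar> \<le> R"
  shows "block_index L (x + z) = block_index L x"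
proof -
  have "(x $ i + z $ i) div L = x $ i div L" for i
    using assms(2)[of i] assms(3)[of i]
    by (intro int_div_pos_eq[of _ _ _ "x $ i mod L + z $ i"]) auto
  then show ?thesis by (simp add: block_index_def)
qed

text \<open>The layer of fixed thickness \<open>R\<close> along the faces is a vanishing fraction of
  a cube of side \<open>m\<close>.\<close>

lemma eventually_power_diff_le:
  assumes "c > 0"
  shows "eventually (\<lambda>m :: nat. real (m ^ d) - real (nat (int m - 2 * R) ^ d) \<le> c * real (m ^ d)) sequentially"
proof -
  have "(\<lambda>m :: nat. 2 * real_of_int R / real m) \<longlonglongrightarrow> 0"
    by (rule lim_const_over_n)
  then have "(\<lambda>m :: nat. (1 - 2 * real_of_int R / real m) ^ d) \<longlonglongrightarrow> (1 - 0) ^ d"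
    by (intro tendsto_intros)
  then have "eventually (\<lambda>m. 1 - c < (1 - 2 * real_of_int R / real m) ^ d) sequentially"
    using assms by (intro order_tendstoD) auto
  then show ?thesis
    \<comment> \<open>For such \<open>m\<close> the \<open>nat\<close> does not truncate and
      division by \<open>m\<close> is harmless.\<close>
    using eventually_ge_at_top[of "nat (2 * R) + 1"]
  proof eventually_elim
    case (elim m)
    have "(1 - c) * real m ^ d \<le> (1 - 2 * real_of_int R / real m) ^ d * real m ^ d"
      using elim by (intro mult_right_mono) auto
    also have "\<dots> = (real m - 2 * real_of_int R) ^ d"
      using elim by (simp add: power_mult_distrib[symmetric] field_simps)
    also have "real m - 2 * real_of_int R = real (nat (int m - 2 * R))"
      using elim by simp
    finally show ?case by (simp add: algebra_simps)
  qed
qed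

text \<open>\<open>J_summable\<close> makes crossing edges rare, \<open>J_axis\<close> with
  \<open>r_pos\<close> gives the lower bound, and \<open>J_le\<close> turns \<open>r < 1\<close>
  into a probability below one for every edge.\<close>

locale invariant_percolation = bond_percolation M E \<kappa>
  for M :: "'w measure"
    and E :: "'w \<Rightarrow> (int ^ 'd) set set"
    and \<kappa> :: "int ^ 'd \<Rightarrow> int ^ 'd \<Rightarrow> real" +
  fixes J :: "int ^ 'd \<Rightarrow> real" and r :: real
  assumes \<kappa>_J: "\<And>x y. x \<noteq> y \<Longrightarrow> \<kappa> x y = J (y - x)"
    and J_nonneg: "\<And>z. 0 \<le> J z"
    and J_summable: "J summable_on UNIV"
    and J_le: "\<And>z. J z \<le> r"
    and J_axis: "\<And>i. J (axis i 1) = r"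
    and r_pos: "0 < r"
begin

lemma edge_pr_J: "x \<noteq> y \<Longrightarrow> edge_pr {x, y} = J (y - x)"
  by (simp add: edge_pr \<kappa>_J)

lemma edge_pr_translate: "e \<in> vertex_pairs \<Longrightarrow> edge_pr ((\<lambda>w. w + a) ` e) = edge_pr e"
  by (auto simp: vertex_pairs_def edge_pr_J)

text \<open>Translation by \<open>- x\<close> takes \<open>V\<close> to a set \<open>W\<close>
  around the origin; by \<open>prob_config_pred\<close> the two local probabilities are the same
  finite sum after reindexing. Dropping the restriction to \<open>W\<close> only enlarges the
  cluster.\<close>

lemma prob_local_cluster_le:
  assumes V: "finite V" "x \<in> V"
  shows "prob {\<omega> \<in> space M. k \<le> card (cluster (induced_subgraph (E \<omega>) V) x)}
    \<le> prob {\<omega> \<in> space M. has_cluster k (E \<omega>) 0}"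
proof -
  define \<tau> where "\<tau> w = w + x" for w :: "int ^ 'd"
  have inj: "inj \<tau>" by (simp add: inj_def \<tau>_def)
  define W where "W = (\<lambda>w. w - x) ` V"
  have W: "V = \<tau> ` W" "finite W" "0 \<in> W"
    using V by (auto simp: W_def \<tau>_def image_image)
  define K where "K V = {e \<in> vertex_pairs. e \<subseteq> V}" for V :: "(int ^ 'd) set"
  have KV: "finite (K V)" "K V \<subseteq> vertex_pairs" and KW: "finite (K W)" "K W \<subseteq> vertex_pairs"
    using V W by (auto simp: K_def finite_pairs_in)
  have K: "K V = (`) \<tau> ` K W"
    unfolding K_def W \<tau>_def by (rule vertex_pairs_translate)
  have inj2: "inj ((`) \<tau>)" using inj by (simp add: inj_image_eq_iff inj_def)
  have ind: "induced_subgraph (E \<omega>) V = E \<omega> \<inter> K V" if "\<omega> \<in> space M" for \<omega> V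
    using edges[OF that] by (auto simp: induced_subgraph_def K_def)
  let ?w = "\<lambda>K F. \<Prod>e\<in>K. if e \<in> F then edge_pr e else 1 - edge_pr e"
  have "prob {\<omega> \<in> space M. k \<le> card (cluster (induced_subgraph (E \<omega>) V) x)}
      = prob {\<omega> \<in> space M. k \<le> card (cluster (E \<omega> \<inter> K V) x)}"
    using ind by (intro arg_cong[of _ _ prob]) auto
  also have "\<dots> = (\<Sum>F\<in>{F \<in> Pow (K V). k \<le> card (cluster F x)}. ?w (K V) F)"
    using KV by (rule prob_config_pred)
  also have "\<dots> = (\<Sum>F\<in>{F \<in> Pow (K W). k \<le> card (cluster F 0)}. ?w (K W) F)"
  proof (rule sum.reindex_cong[of "(`) ((`) \<tau>)"])
    show "inj_on ((`) ((`) \<tau>)) {F \<in> Pow (K W). k \<le> card (cluster F 0)}"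
    proof (rule inj_onI)
      fix F F' assume "(`) \<tau> ` F = (`) \<tau> ` F'"
      then show "F = F'" using inj2 by (simp only: inj_image_eq_iff)
    qed
    have card_eq: "card (cluster ((`) \<tau> ` F) x) = card (cluster F 0)" for F
    proof -
      have "cluster ((`) \<tau> ` F) (\<tau> 0) = \<tau> ` cluster F 0"
        using inj by (rule cluster_image_inj)
      then show ?thesis
        using inj by (simp add: \<tau>_def card_image inj_on_subset[of _ UNIV])
    qed
    show "{F \<in> Pow (K V). k \<le> card (cluster F x)}
        = (`) ((`) \<tau>) ` {F \<in> Pow (K W). k \<le> card (cluster F 0)}"
    proof (intro equalityI subsetI)
      fix F assume F: "F \<in> {F \<in> Pow (K V). k \<le> card (cluster F x)}"
      then obtain F' where "F' \<subseteq> K W" "F = (`) \<tau> ` F'"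
        unfolding K by (auto simp: subset_image_iff)
      with F show "F \<in> (`) ((`) \<tau>) ` {F \<in> Pow (K W). k \<le> card (cluster F 0)}"
        using card_eq by auto
    next
      fix F assume "F \<in> (`) ((`) \<tau>) ` {F \<in> Pow (K W). k \<le> card (cluster F 0)}"
      then obtain F' where "F' \<subseteq> K W" "F = (`) \<tau> ` F'" "k \<le> card (cluster F' 0)"
        by auto
      then show "F \<in> {F \<in> Pow (K V). k \<le> card (cluster F x)}"
        using card_eq unfolding K by (auto intro: image_mono)
    qed
    fix F assume "F \<in> {F \<in> Pow (K W). k \<le> card (cluster F 0)}"
    show "?w (K V) ((`) \<tau> ` F) = ?w (K W) F"
    proof -
      have "inj_on ((`) \<tau>) (K W)" using inj2 by (rule inj_on_subset) simp
      then have "?w (K V) ((`) \<tau> ` F) =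
          prod ((\<lambda>e. if e \<in> (`) \<tau> ` F then edge_pr e else 1 - edge_pr e) \<circ> (`) \<tau>) (K W)"
        unfolding K by (rule prod.reindex)
      also have "\<dots> = ?w (K W) F"
      proof (rule prod.cong)
        fix e assume "e \<in> K W"
        then have "edge_pr (\<tau> ` e) = edge_pr e"
          using edge_pr_translate[of e x] by (simp add: K_def \<tau>_def[abs_def])
        moreover have "\<tau> ` e \<in> (`) \<tau> ` F \<longleftrightarrow> e \<in> F"
          using inj2 by (rule inj_image_mem_iff)
        ultimately show "((\<lambda>e. if e \<in> (`) \<tau> ` F then edge_pr e else 1 - edge_pr e) \<circ> (`) \<tau>) e
            = (if e \<in> F then edge_pr e else 1 - edge_pr e)"
          by simp
      qed simp
      finally show ?thesis .
    qed
  qed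
  also have "\<dots> = prob {\<omega> \<in> space M. k \<le> card (cluster (E \<omega> \<inter> K W) 0)}"
    using KW by (rule prob_config_pred[symmetric])
  also have "\<dots> \<le> prob {\<omega> \<in> space M. has_cluster k (E \<omega>) 0}"
  proof (rule finite_measure_mono)
    show "{\<omega> \<in> space M. k \<le> card (cluster (E \<omega> \<inter> K W) 0)} \<subseteq> {\<omega> \<in> space M. has_cluster k (E \<omega>) 0}"
    proof safe
      fix \<omega> assume \<omega>: "\<omega> \<in> space M" "k \<le> card (cluster (E \<omega> \<inter> K W) 0)"
      have "finite (cluster (E \<omega> \<inter> K W) 0)"
        using cluster_induced_subset[OF W(3), of "E \<omega>"] W(2) ind[OF \<omega>(1), of W]
        by (simp add: finite_subset)
      then have "has_cluster k (E \<omega> \<inter> K W) 0"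
        using \<omega>(2) by (simp add: has_cluster_finite)
      then show "has_cluster k (E \<omega>) 0"
        by (rule has_cluster_mono[rotated]) simp
    qed
  qed (rule has_cluster_event)
  finally show ?thesis .
qed

lemma expectation_block_count_le:
  assumes V: "finite V"
  shows "expectation (\<lambda>\<omega>. real (block_count k (E \<omega>) V))
    \<le> real (card V) * prob {\<omega> \<in> space M. has_cluster k (E \<omega>) 0}"
proof -
  let ?A = "\<lambda>x. {\<omega> \<in> space M. k \<le> card (cluster (induced_subgraph (E \<omega>) V) x)}"
  have ev: "?A x \<in> events" for x
  proof -
    have "?A x = {\<omega> \<in> space M. k \<le> card (cluster (E \<omega> \<inter> {e \<in> vertex_pairs. e \<subseteq> V}) x)}"
      using edges by (auto simp: induced_subgraph_eq)
    also have "\<dots> \<in> events"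
      using V by (intro config_event) (auto simp: finite_pairs_in)
    finally show ?thesis .
  qed
  have "expectation (\<lambda>\<omega>. real (block_count k (E \<omega>) V)) = expectation (\<lambda>\<omega>. \<Sum>x\<in>V. indicator (?A x) \<omega>)"
  proof (rule Bochner_Integration.integral_cong)
    fix \<omega> assume "\<omega> \<in> space M"
    then have "(\<Sum>x\<in>V. indicator (?A x) \<omega> :: real)
        = (\<Sum>x\<in>{x \<in> V. k \<le> card (cluster (induced_subgraph (E \<omega>) V) x)}. 1)"
      using V by (intro sum.mono_neutral_cong_right) (auto simp: indicator_def)
    then show "real (block_count k (E \<omega>) V) = (\<Sum>x\<in>V. indicator (?A x) \<omega>)"
      by (simp add: block_count_def)
  qed simp
  also have "\<dots> = (\<Sum>x\<in>V. prob (?A x))"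
    using ev by (subst Bochner_Integration.integral_sum)
      (auto simp: less_top[symmetric] intro!: integrable_real_indicator sum.cong)
  also have "\<dots> \<le> (\<Sum>x\<in>V. prob {\<omega> \<in> space M. has_cluster k (E \<omega>) 0})"
    using V prob_local_cluster_le by (intro sum_mono) auto
  finally show ?thesis by simp
qed

section \<open>Mean number of edges between different cubes\<close>

lemma sum_J_le: "finite T \<Longrightarrow> sum J T \<le> infsum J UNIV"
  using J_summable J_nonneg by (intro finite_sum_le_infsum) auto

lemma J_tail:
  assumes "\<epsilon> > 0"
  obtains T where "finite T" "\<And>W. finite W \<Longrightarrow> W \<inter> T = {} \<Longrightarrow> sum J W \<le> \<epsilon>"
proof -
  have "(J has_sum infsum J UNIV) UNIV"
    using J_summable by (rule has_sum_infsum)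
  then have "eventually (\<lambda>T. infsum J UNIV - \<epsilon> < sum J T) (finite_subsets_at_top UNIV)"
    unfolding has_sum_def using assms by (intro order_tendstoD) auto
  then obtain T where T: "finite T" "infsum J UNIV - \<epsilon> < sum J T"
    unfolding eventually_finite_subsets_at_top by blast
  have "sum J W \<le> \<epsilon>" if "finite W" "W \<inter> T = {}" for W
    using sum_J_le[of "W \<union> T"] T that by (simp add: sum.union_disjoint)
  with T(1) show ?thesis using that by blast
qed

text \<open>Each crossing pair arises from two ordered pairs; the factor 2 is given away, since only
  an upper bound is wanted.\<close>

lemma crossing_mean_le_sum:
  assumes V: "finite V"
  shows "(\<Sum>e\<in>crossing_pairs b V. edge_pr e) \<le> (\<Sum>x\<in>V. \<Sum>y\<in>{y \<in> V. b y \<noteq> b x}. J (y - x))"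
proof -
  let ?D = "SIGMA x:V. {y \<in> V. b y \<noteq> b x}"
  have "crossing_pairs b V \<subseteq> (\<lambda>(x, y). {x, y}) ` ?D"
  proof
    fix e assume "e \<in> crossing_pairs b V"
    then obtain x y where e: "e = {x, y}" "x \<in> V" "y \<in> V" "\<nexists>u. e \<subseteq> b -` {u}"
      by (auto simp: crossing_pairs_def vertex_pairs_def)
    from e(4) have "b y \<noteq> b x" unfolding e(1) by (intro notI) auto
    with e show "e \<in> (\<lambda>(x, y). {x, y}) ` ?D" by (intro image_eqI[of _ _ "(x, y)"]) auto
  qed
  moreover have fin: "finite ?D" using V by auto
  ultimately have "(\<Sum>e\<in>crossing_pairs b V. edge_pr e) \<le> (\<Sum>e\<in>(\<lambda>(x, y). {x, y}) ` ?D. edge_pr e)"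
    by (intro sum_mono2) (auto simp: edge_pr_nonneg)
  also have "\<dots> \<le> sum (edge_pr \<circ> (\<lambda>(x, y). {x, y})) ?D"
    using fin edge_pr_nonneg by (intro sum_image_le) auto
  also have "\<dots> = (\<Sum>(x, y)\<in>?D. J (y - x))"
    by (intro sum.cong) (auto intro!: edge_pr_J)
  also have "\<dots> = (\<Sum>x\<in>V. \<Sum>y\<in>{y \<in> V. b y \<noteq> b x}. J (y - x))"
    using V by (subst sum.Sigma) auto
  finally show ?thesis .
qed

text \<open>All but \<epsilon>/2 of the mass of \<open>J\<close> sits on a finite set
  \<open>T\<close> of displacements. Vertices deep inside a block can leave it only by displacements
  outside \<open>T\<close>; the others may cost the full mass \<open>S\<close>, but for large
  \<open>L\<close> they are a small fraction of the block.\<close>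

lemma crossing_mean_small:
  assumes "\<epsilon> > 0"
  obtains L where "0 < L"
    "\<And>V U. finite V \<Longrightarrow> finite U \<Longrightarrow> block_index (int L) ` V \<subseteq> U \<Longrightarrow>
      (\<Sum>e\<in>crossing_pairs (block_index (int L)) V. edge_pr e) \<le> \<epsilon> * (real (card U) * real L ^ CARD('d))"
proof -
  define S where "S = infsum J UNIV"
  have S: "S \<ge> 0" unfolding S_def by (simp add: infsum_nonneg J_nonneg)
  obtain T where T: "finite T" "\<And>W. finite W \<Longrightarrow> W \<inter> T = {} \<Longrightarrow> sum J W \<le> \<epsilon> / 2"
    using J_tail[of "\<epsilon> / 2"] assms by auto
  \<comment> \<open>A bound for all coordinates of \<open>T\<close>; a sum, unlike a maximum, also
    covers an empty \<open>T\<close>.\<close>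
  define R where "R = (\<Sum>z\<in>T. \<Sum>i\<in>UNIV. \<bar>z $ i\<bar>)"
  have R0: "R \<ge> 0" by (simp add: R_def sum_nonneg)
  have R: "\<bar>z $ i\<bar> \<le> R" if "z \<in> T" for z i
  proof -
    have "\<bar>z $ i\<bar> \<le> (\<Sum>i\<in>UNIV. \<bar>z $ i\<bar>)" by (rule member_le_sum) auto
    also have "\<dots> \<le> R" unfolding R_def using that T(1) by (intro member_le_sum) (auto intro: sum_nonneg)
    finally show ?thesis .
  qed
  \<comment> \<open>The fraction of boundary vertices is chosen so that they contribute at most
    \<epsilon>/2 per vertex of the block; \<open>S + 1\<close> instead of \<open>S\<close> keeps the
    denominator positive.\<close>
  have "eventually (\<lambda>m :: nat. m > 0 \<and> real (m ^ CARD('d)) - real (nat (int m - 2 * R) ^ CARD('d))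
      \<le> (\<epsilon> / 2 / (S + 1)) * real (m ^ CARD('d))) sequentially"
    using assms S by (intro eventually_conj eventually_power_diff_le eventually_gt_at_top) auto
  from eventually_happens'[OF sequentially_bot this]
  obtain L :: nat where L: "L > 0" "real (L ^ CARD('d)) - real (nat (int L - 2 * R) ^ CARD('d))
      \<le> (\<epsilon> / 2 / (S + 1)) * real (L ^ CARD('d))"
    by blast
  let ?b = "block_index (int L) :: int ^ 'd \<Rightarrow> _"
  let ?I = "\<lambda>x :: int ^ 'd. \<forall>i. x $ i mod int L \<in> {R..<int L - R}"
  \<comment> \<open>A bound for the mean number of edges from \<open>x\<close> into other blocks,
    according to whether \<open>x\<close> is interior.\<close>
  let ?c = "\<lambda>x. if ?I x then \<epsilon> / 2 else S"
  have block: "(\<Sum>x\<in>?b -` {u}. ?c x) \<le> \<epsilon> * real L ^ CARD('d)" for u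
  proof -
    let ?B = "?b -` {u}"
    have fin: "finite ?B" using L(1) by (intro finite_block) simp
    have cardB: "card ?B = L ^ CARD('d)" using L(1) by (simp add: card_block)
    have cardI: "card {x \<in> ?B. ?I x} = nat (int L - 2 * R) ^ CARD('d)"
      using L(1) R0 by (intro card_block_interior) auto
    have split: "card ?B = card {x \<in> ?B. ?I x} + card {x \<in> ?B. \<not> ?I x}"
    proof -
      have "finite {x \<in> ?B. ?I x}" "finite {x \<in> ?B. \<not> ?I x}"
        by (rule rev_finite_subset[OF fin], blast)+
      then have "card ({x \<in> ?B. ?I x} \<union> {x \<in> ?B. \<not> ?I x}) = card {x \<in> ?B. ?I x} + card {x \<in> ?B. \<not> ?I x}"
        by (rule card_Un_disjoint) blast
      moreover have "{x \<in> ?B. ?I x} \<union> {x \<in> ?B. \<not> ?I x} = ?B" by blast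
      ultimately show ?thesis by (simp only:)
    qed
    have "(\<Sum>x\<in>?B. ?c x) = (\<Sum>x\<in>?B \<inter> {x. ?I x}. \<epsilon> / 2) + (\<Sum>x\<in>?B \<inter> - {x. ?I x}. S)"
      using fin by (rule sum.If_cases)
    also have "\<dots> = \<epsilon> / 2 * card {x \<in> ?B. ?I x} + S * card {x \<in> ?B. \<not> ?I x}"
      by (simp add: Int_def)
    also have "\<dots> \<le> \<epsilon> / 2 * card ?B + (S + 1) * card {x \<in> ?B. \<not> ?I x}"
      using assms split S by (intro add_mono mult_mono) auto
    also have "real (card {x \<in> ?B. \<not> ?I x}) = real (L ^ CARD('d)) - real (nat (int L - 2 * R) ^ CARD('d))"
      using split unfolding cardI cardB by simp
    also have "(S + 1) * \<dots> \<le> (S + 1) * (\<epsilon> / 2 / (S + 1) * real (L ^ CARD('d)))"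
      using L(2) S by (intro mult_left_mono) auto
    also have "\<dots> = \<epsilon> / 2 * real (L ^ CARD('d))"
    proof -
      have "s * (a / s * b) = a * b" if "s \<noteq> 0" for s a b :: real
        using that by simp
      moreover have "S + 1 \<noteq> 0" using S by linarith
      ultimately show ?thesis by blast
    qed
    finally show ?thesis unfolding cardB by simp
  qed
  have "(\<Sum>e\<in>crossing_pairs ?b V. edge_pr e) \<le> \<epsilon> * (real (card U) * real L ^ CARD('d))"
    if V: "finite V" and U: "finite U" "?b ` V \<subseteq> U" for V U
  proof -
    have c: "(\<Sum>y\<in>{y \<in> V. ?b y \<noteq> ?b x}. J (y - x)) \<le> ?c x" for x
    proof -
      let ?Y = "{y \<in> V. ?b y \<noteq> ?b x}"
      have eq: "(\<Sum>y\<in>?Y. J (y - x)) = sum J ((\<lambda>y. y - x) ` ?Y)"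
        by (subst sum.reindex) (auto simp: inj_on_def)
      have fin: "finite ((\<lambda>y. y - x) ` ?Y)" using V by simp
      show ?thesis
      proof (cases "?I x")
        case True
        have "(\<lambda>y. y - x) ` ?Y \<inter> T = {}"
        proof (rule ccontr)
          assume "(\<lambda>y. y - x) ` ?Y \<inter> T \<noteq> {}"
          then obtain y where y: "?b y \<noteq> ?b x" "y - x \<in> T" by auto
          have "?b (x + (y - x)) = ?b x"
            using True R[OF y(2)] L(1) by (intro block_index_add[of _ _ R]) auto
          with y(1) show False by simp
        qed
        with T(2)[OF fin] True show ?thesis unfolding eq by simp
      next
        case False
        then have "?c x = S" by (rule if_not_P)
        then show ?thesis unfolding eq S_def using sum_J_le[OF fin] by (simp only:)
      qed
    qed
    have "(\<Sum>e\<in>crossing_pairs ?b V. edge_pr e) \<le> (\<Sum>x\<in>V. ?c x)"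
      using crossing_mean_le_sum[OF V, of ?b] c by (meson order_trans sum_mono)
    \<comment> \<open>Passing to complete blocks is allowed because \<open>?c\<close> is
      nonnegative, and makes the estimate per block applicable.\<close>
    also have "\<dots> \<le> (\<Sum>x\<in>(\<Union>u\<in>U. ?b -` {u}). ?c x)"
      using U L(1) assms S by (intro sum_mono2) (auto intro: finite_block)
    also have "\<dots> = (\<Sum>u\<in>U. \<Sum>x\<in>?b -` {u}. ?c x)"
      using U(1) L(1) by (intro sum.UNION_disjoint) (auto intro: finite_block)
    also have "\<dots> \<le> (\<Sum>u\<in>U. \<epsilon> * real L ^ CARD('d))"
      by (intro sum_mono block)
    finally show ?thesis by (simp add: mult_ac)
  qed
  with L(1) show ?thesis using that by blast
qed

end

section \<open>Bounds for the largest component\<close>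

lemma lattice_box_eq:
  "lattice_box n = {x :: int ^ 'd. \<forall>i. \<bar>x $ i\<bar> \<le> \<lfloor>real n powr (1 / real CARD('d)) / 2\<rfloor>}"
proof -
  have "real_of_int z \<in> {- s..s} \<longleftrightarrow> \<bar>z\<bar> \<le> \<lfloor>s\<rfloor>" for z s
  proof -
    have "\<bar>z\<bar> \<le> \<lfloor>s\<rfloor> \<longleftrightarrow> \<bar>real_of_int z\<bar> \<le> s" by (simp add: le_floor_iff)
    then show ?thesis by (auto simp: abs_le_iff)
  qed
  then show ?thesis unfolding lattice_box_def by blast
qed

lemma zero_in_lattice_box: "0 \<in> lattice_box n"
  by (simp add: lattice_box_eq)

lemma power_root_nat: "0 < d \<Longrightarrow> 0 < n \<Longrightarrow> (real n powr (1 / real d)) ^ d = real n"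
  by (simp add: powr_realpow[symmetric] powr_powr)

lemma card_lattice_box_le:
  assumes "n \<ge> 1"
  shows "real (card (lattice_box n :: (int ^ 'd) set)) \<le> 2 ^ CARD('d) * real n"
proof -
  define x where "x = real n powr (1 / real CARD('d))"
  have x: "x \<ge> 1" using assms by (simp add: x_def ge_one_powr_ge_zero)
  have "real (card (lattice_box n :: (int ^ 'd) set)) = real (nat (2 * \<lfloor>x / 2\<rfloor> + 1)) ^ CARD('d)"
    by (simp add: card_lattice_box x_def)
  \<comment> \<open>The base is at most \<open>x + 1\<close>, and \<open>x \<ge> 1\<close>.\<close>
  also have "\<dots> \<le> (2 * x) ^ CARD('d)"
    using x by (intro power_mono) linarith+
  also have "\<dots> = 2 ^ CARD('d) * real n"
    using assms power_root_nat[of "CARD('d)" n] by (simp add: power_mult_distrib x_def)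
  finally show ?thesis .
qed

text \<open>In each direction the blocks meeting the box cover a length of at most
  \<open>x n + 2 * real L\<close>; as \<open>L\<close> is fixed and the side \<open>x n\<close>
  grows, the excess volume is a vanishing fraction of \<open>n\<close>.\<close>

lemma lattice_box_blocks:
  assumes L: "0 < L" and \<eta>: "\<eta> > 0"
  shows "eventually (\<lambda>n. \<exists>U :: (int ^ 'd) set. finite U \<and> block_index (int L) ` lattice_box n \<subseteq> U \<and>
    real (card U) * real L ^ CARD('d) \<le> (1 + \<eta>) * real n) sequentially"
proof -
  define x where "x n = real n powr (1 / real CARD('d))" for n :: nat
  have "(\<lambda>n. real n powr - (1 / real CARD('d))) \<longlonglongrightarrow> 0"
    by (intro tendsto_neg_powr filterlim_real_sequentially) auto
  then have "(\<lambda>n. inverse (x n)) \<longlonglongrightarrow> 0"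
    by (simp add: x_def powr_minus)
  then have "(\<lambda>n. (1 + 2 * real L * inverse (x n)) ^ CARD('d)) \<longlonglongrightarrow> (1 + 2 * real L * 0) ^ CARD('d)"
    by (intro tendsto_intros)
  then have "eventually (\<lambda>n. (1 + 2 * real L * inverse (x n)) ^ CARD('d) < 1 + \<eta>) sequentially"
    using \<eta> by (intro order_tendstoD) auto
  then show ?thesis
    using eventually_ge_at_top[of 1]
  proof eventually_elim
    case (elim n)
    define f where "f = \<lfloor>x n / 2\<rfloor>"
    have x: "x n \<ge> 1" using elim by (simp add: x_def ge_one_powr_ge_zero)
    have xn: "x n ^ CARD('d) = real n" using elim power_root_nat[of "CARD('d)" n] by (simp add: x_def)
    let ?S = "{(- f) div int L..f div int L}"
    let ?U = "{u :: int ^ 'd. \<forall>i. u $ i \<in> ?S}"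
    have sub: "block_index (int L) ` lattice_box n \<subseteq> ?U"
      using L by (auto simp: lattice_box_eq block_index_def f_def x_def abs_le_iff intro!: zdiv_mono1)
        (smt (verit) of_nat_0_less_iff zdiv_mono1)+
    \<comment> \<open>One \<open>L\<close> is lost by rounding at the lower end and one by counting
      both end indices, hence \<open>2 * real L\<close> below.\<close>
    have "real_of_int (int L * (f div int L)) \<le> real_of_int f"
      unfolding of_int_le_iff using L by (simp add: minus_mod_eq_mult_div[symmetric])
    moreover have "real_of_int (int L * ((- f) div int L)) \<ge> real_of_int (- f - int L)"
    proof -
      have "(- f) mod int L < int L" using L by simp
      then show ?thesis unfolding of_int_le_iff minus_mod_eq_mult_div[symmetric] by linarith
    qed
    moreover have "real_of_int f \<le> x n / 2" unfolding f_def by (rule of_int_floor_le)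
    ultimately have "real L * real_of_int (f div int L - (- f) div int L + 1) \<le> x n + 2 * real L"
      by (simp add: algebra_simps)
    moreover have "f div int L - (- f) div int L + 1 \<ge> 0"
    proof -
      have "f \<ge> 0" using x by (simp add: f_def)
      then have "(- f) div int L \<le> f div int L" using L by (intro zdiv_mono1) auto
      then show ?thesis by simp
    qed
    ultimately have le: "real L * real (card ?S) \<le> x n + 2 * real L"
      by (simp add: algebra_simps)
    have "real (card ?U) * real L ^ CARD('d) = (real L * real (card ?S)) ^ CARD('d)"
      by (subst card_vec_Collect(2)) (simp_all add: power_mult_distrib)
    also have "\<dots> \<le> (x n + 2 * real L) ^ CARD('d)"
      using le by (intro power_mono) auto
    also have "x n + 2 * real L = (1 + 2 * real L * inverse (x n)) * x n"
      using x by (simp add: field_simps)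
    also have "\<dots> ^ CARD('d) = (1 + 2 * real L * inverse (x n)) ^ CARD('d) * real n"
      by (simp add: power_mult_distrib xn)
    also have "\<dots> \<le> (1 + \<eta>) * real n"
      using elim by (intro mult_right_mono) auto
    finally show ?case
      using sub card_vec_Collect(1)[of ?S] by blast
  qed
qed

text \<open>Move one nonzero coordinate of \<open>x\<close> a step towards 0: this lowers the
  l1-norm, and \<open>down\<close> and \<open>up\<close> keep the step inside
  \<open>\<Lambda>\<close>. Serves both the box and the whole lattice.\<close>

lemma nearest_neighbor_connected:
  fixes \<Lambda> :: "(int ^ 'd) set"
  assumes down: "\<And>x i. x \<in> \<Lambda> \<Longrightarrow> 0 < x $ i \<Longrightarrow> x - axis i 1 \<in> \<Lambda>"
    and up: "\<And>x i. x \<in> \<Lambda> \<Longrightarrow> x $ i < 0 \<Longrightarrow> x + axis i 1 \<in> \<Lambda>"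
    and G: "\<And>x i. x \<in> \<Lambda> \<Longrightarrow> {x, x + axis i 1} \<in> G"
    and "x \<in> \<Lambda>"
  shows "x \<in> cluster (induced_subgraph G \<Lambda>) 0"
  using \<open>x \<in> \<Lambda>\<close>
proof (induction "nat (\<Sum>i\<in>UNIV. \<bar>x $ i\<bar>)" arbitrary: x rule: less_induct)
  case less
  show ?case
  proof (cases "x = 0")
    case False
    then obtain i where i: "x $ i \<noteq> 0" by (auto simp: vec_eq_iff)
    define y where "y = (if 0 < x $ i then x - axis i 1 else x + axis i 1)"
    have y: "y \<in> \<Lambda>" using less.prems down up i by (auto simp: y_def)
    have "(\<Sum>j\<in>UNIV. \<bar>y $ j\<bar>) < (\<Sum>j\<in>UNIV. \<bar>x $ j\<bar>)"
      using i by (intro sum_strict_mono_ex1) (auto simp: y_def axis_def)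
    moreover have "0 \<le> (\<Sum>j\<in>UNIV. \<bar>y $ j\<bar>)" by (rule sum_nonneg) simp
    ultimately have "nat (\<Sum>j\<in>UNIV. \<bar>y $ j\<bar>) < nat (\<Sum>j\<in>UNIV. \<bar>x $ j\<bar>)"
      by linarith
    then have "y \<in> cluster (induced_subgraph G \<Lambda>) 0" using y by (rule less.hyps)
    moreover have "{y, x} \<in> induced_subgraph G \<Lambda>"
      using G[OF y, of i] G[OF less.prems, of i] y less.prems
      by (cases "0 < x $ i") (auto simp: induced_subgraph_def y_def insert_commute)
    ultimately show ?thesis by (rule cluster_step)
  qed simp
qed

lemma infinite_UNIV_lattice: "infinite (UNIV :: (int ^ 'd) set)"
proof -
  have "inj (\<lambda>m :: int. axis undefined m :: int ^ 'd)"
    by (auto simp: inj_def axis_eq_axis)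
  then show ?thesis
    using infinite_UNIV_int finite_imageD finite_subset subset_UNIV by metis
qed

lemma axis_pair: "{x, x + axis i (1 :: int)} \<in> vertex_pairs"
proof -
  have "axis i (1 :: int) \<noteq> 0" by (simp add: axis_eq_0_iff)
  then have "x \<noteq> x + axis i 1" by simp
  then show ?thesis unfolding vertex_pairs_def by blast
qed

lemma largest_component_size_restrict:
  "G \<subseteq> vertex_pairs \<Longrightarrow>
    largest_component_size (G \<inter> {e \<in> vertex_pairs. e \<subseteq> V}) V = largest_component_size G V"
  by (simp add: largest_component_size_def components_on_def induced_subgraph_eq Int_assoc inf.coboundedI1)

lemma largest_component_attained:
  assumes "finite V" "V \<noteq> {}"
  obtains x where "x \<in> V" "largest_component_size G V = card (cluster (induced_subgraph G V) x)"
proof -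
  have "largest_component_size G V \<in> card ` components_on G V"
    unfolding largest_component_size_def components_on_def using assms by (intro Max_in) auto
  then show ?thesis using that by (auto simp: components_on_def)
qed

lemma card_cluster_le_largest:
  assumes "finite V" "x \<in> V"
  shows "card (cluster (induced_subgraph G V) x) \<le> largest_component_size G V"
  unfolding largest_component_size_def components_on_def using assms by (intro Max_ge) auto

section \<open>Probability bounds for the largest component\<close>

context invariant_percolation
begin

lemma r_le_1: "r \<le> 1"
proof -
  have "axis i (1 :: int) \<noteq> 0" for i :: 'd by (simp add: axis_eq_0_iff)
  then have "edge_pr {0, axis undefined 1} = r"
    using edge_pr_J[of 0 "axis undefined 1"] J_axis by simp
  then show ?thesis using edge_pr_le_1 by metis
qed

lemma edge_pr_axis: "edge_pr {x, x + axis i 1} = r"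
proof -
  have "axis i (1 :: int) \<noteq> 0" by (simp add: axis_eq_0_iff)
  then show ?thesis using edge_pr_J[of x "x + axis i 1"] J_axis by simp
qed

lemma edge_pr_le_r: "e \<in> vertex_pairs \<Longrightarrow> edge_pr e \<le> r"
  using J_le by (auto simp: vertex_pairs_def edge_pr_J)

text \<open>If \<open>r = 1\<close>, then almost surely all of the countably many nearest-neighbour
  edges are open, and the cluster of the origin is the whole lattice.\<close>

lemma r_less_1:
  assumes "percolation_prob M E < 1"
  shows "r < 1"
proof (rule ccontr)
  assume "\<not> r < 1"
  then have r: "r = 1" using r_le_1 by simp
  have "AE \<omega> in M. {x, x + axis i 1} \<in> E \<omega>" for x i
    using edge_pr_axis[of x i] edge_event[OF axis_pair, of x i]
    by (simp add: edge_pr_def r prob_Collect_eq_1)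
  then have "AE \<omega> in M. \<forall>x i. {x, x + axis i 1} \<in> E \<omega>"
    by (simp add: AE_all_countable)
  then have "AE \<omega> in M. infinite (cluster (E \<omega>) 0)"
  proof eventually_elim
    case (elim \<omega>)
    have "x \<in> cluster (induced_subgraph (E \<omega>) UNIV) 0" for x
      using elim by (intro nearest_neighbor_connected) auto
    then have "cluster (E \<omega>) 0 = UNIV" by (auto simp: induced_subgraph_def)
    then show ?case using infinite_UNIV_lattice by simp
  qed
  then have "percolation_prob M E = 1"
    using infinite_cluster_event[of 0] by (simp add: percolation_prob_def prob_Collect_eq_1)
  with assms show False by simp
qed

lemma large_component_event:
  "{\<omega> \<in> space M. t < real (largest_component_size (E \<omega>) (lattice_box n))} \<in> events"
proof -
  let ?K = "{e \<in> vertex_pairs. e \<subseteq> lattice_box n}"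
  have "{\<omega> \<in> space M. t < real (largest_component_size (E \<omega> \<inter> ?K) (lattice_box n))} \<in> events"
    using finite_pairs_in[OF finite_lattice_box] by (intro config_event) auto
  also have "{\<omega> \<in> space M. t < real (largest_component_size (E \<omega> \<inter> ?K) (lattice_box n))}
      = {\<omega> \<in> space M. t < real (largest_component_size (E \<omega>) (lattice_box n))}"
    using largest_component_size_restrict[OF edges, of _ "lattice_box n"]
    by (intro Collect_cong conj_cong) auto
  finally show ?thesis .
qed

text \<open>Opening the edges along the axes from every vertex connects the whole box, which is
  large enough by \<open>size\<close>. Their number is at most \<open>CARD('d)\<close> times the
  number of vertices, so independence gives an exponential cost in \<open>n\<close>.\<close>

lemma large_component_prob_ge:
  assumes n: "n \<ge> 1" and size: "\<rho> * real n < real (card (lattice_box n :: (int ^ 'd) set))"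
  shows "r powr (real CARD('d) * 2 ^ CARD('d) * real n) \<le> large_component_prob M E \<rho> n"
proof -
  let ?\<Lambda> = "lattice_box n :: (int ^ 'd) set"
  \<comment> \<open>Some of these edges leave the box; keeping them makes the count immediate and
    every edge of the same form.\<close>
  define F where "F = (\<lambda>(x, i). {x, x + axis i 1}) ` (?\<Lambda> \<times> (UNIV :: 'd set))"
  have F: "finite F" "F \<subseteq> vertex_pairs"
    using axis_pair by (auto simp: F_def finite_lattice_box)
  have "card F \<le> card (?\<Lambda> \<times> (UNIV :: 'd set))"
    unfolding F_def by (rule card_image_le) (simp add: finite_lattice_box)
  also have "\<dots> = CARD('d) * card ?\<Lambda>" by (simp add: card_cartesian_product)
  finally have "real (card F) \<le> real CARD('d) * real (card ?\<Lambda>)"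
    by (metis of_nat_le_iff of_nat_mult)
  also have "\<dots> \<le> real CARD('d) * (2 ^ CARD('d) * real n)"
    using n by (intro mult_left_mono card_lattice_box_le) auto
  finally have "r powr (real CARD('d) * 2 ^ CARD('d) * real n) \<le> r powr real (card F)"
    using r_pos r_le_1 by (intro powr_mono') (auto simp: mult.assoc)
  also have "\<dots> = (\<Prod>e\<in>F. edge_pr e)"
  proof -
    have "(\<Prod>e\<in>F. edge_pr e) = (\<Prod>e\<in>F. r)"
      by (intro prod.cong) (auto simp: F_def edge_pr_axis)
    then show ?thesis using r_pos by (simp add: powr_realpow)
  qed
  also have "\<dots> = prob {\<omega> \<in> space M. F \<subseteq> E \<omega>}"
    using F by (rule prob_edges[symmetric])
  also have "\<dots> \<le> large_component_prob M E \<rho> n"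
    unfolding large_component_prob_def
  proof (rule finite_measure_mono[OF _ large_component_event], safe)
    fix \<omega> assume \<omega>: "\<omega> \<in> space M" "F \<subseteq> E \<omega>"
    have "?\<Lambda> \<subseteq> cluster (induced_subgraph (E \<omega>) ?\<Lambda>) 0"
    proof
      fix x assume "x \<in> ?\<Lambda>"
      then show "x \<in> cluster (induced_subgraph (E \<omega>) ?\<Lambda>) 0"
      proof (rule nearest_neighbor_connected[rotated 3])
        fix x i assume x: "x \<in> ?\<Lambda>"
        then show "{x, x + axis i 1} \<in> E \<omega>" using \<omega>(2) by (auto simp: F_def)
        {
          assume "0 < x $ i"
          then have "\<bar>(x - axis i 1) $ j\<bar> \<le> \<bar>x $ j\<bar>" for j by (auto simp: axis_def)
          then show "x - axis i 1 \<in> ?\<Lambda>" using x unfolding lattice_box_eq by (blast intro: order_trans)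
        }
        {
          assume "x $ i < 0"
          then have "\<bar>(x + axis i 1) $ j\<bar> \<le> \<bar>x $ j\<bar>" for j by (auto simp: axis_def)
          then show "x + axis i 1 \<in> ?\<Lambda>" using x unfolding lattice_box_eq by (blast intro: order_trans)
        }
      qed
    qed
    then have "card ?\<Lambda> \<le> card (cluster (induced_subgraph (E \<omega>) ?\<Lambda>) 0)"
      using cluster_induced_subset[OF zero_in_lattice_box, of "E \<omega>" n] finite_lattice_box
      by (simp add: card_mono finite_subset)
    also have "\<dots> \<le> largest_component_size (E \<omega>) ?\<Lambda>"
      using finite_lattice_box zero_in_lattice_box by (rule card_cluster_le_largest)
    finally show "\<rho> * real n < real (largest_component_size (E \<omega>) ?\<Lambda>)"
      using size by linarith
  qed
  finally show ?thesis .
qed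

text \<open>With positive probability, a finite product of positive factors, the box has no open
  edge. Then its largest component is a single vertex, which does not exceed
  \<open>\<rho> * real n\<close>.\<close>

lemma large_component_prob_less_1:
  assumes r: "r < 1" and size: "1 \<le> \<rho> * real n"
  shows "large_component_prob M E \<rho> n < 1"
proof -
  let ?\<Lambda> = "lattice_box n :: (int ^ 'd) set"
  let ?K = "{e \<in> vertex_pairs. e \<subseteq> ?\<Lambda>}"
  let ?A = "{\<omega> \<in> space M. \<rho> * real n < real (largest_component_size (E \<omega>) ?\<Lambda>)}"
  let ?N = "{\<omega> \<in> space M. E \<omega> \<inter> ?K = {}}"
  have K: "finite ?K" "?K \<subseteq> vertex_pairs" by (auto simp: finite_pairs_in finite_lattice_box)
  have "prob ?N = (\<Prod>e\<in>?K. if e \<in> {} then edge_pr e else 1 - edge_pr e)"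
    using K by (intro prob_config) auto
  also have "\<dots> > 0"
    using r edge_pr_le_r by (intro prod_pos) force
  finally have pos: "prob ?N > 0" .
  have "?A \<inter> ?N = {}"
  proof safe
    fix \<omega> assume \<omega>: "\<omega> \<in> space M" "E \<omega> \<inter> ?K = {}" "\<rho> * real n < real (largest_component_size (E \<omega>) ?\<Lambda>)"
    have "induced_subgraph (E \<omega>) ?\<Lambda> = {}"
      using \<omega>(2) edges[OF \<omega>(1)] by (simp add: induced_subgraph_eq)
    moreover obtain x where "largest_component_size (E \<omega>) ?\<Lambda> = card (cluster (induced_subgraph (E \<omega>) ?\<Lambda>) x)"
      using largest_component_attained[OF finite_lattice_box] zero_in_lattice_box by blast
    ultimately have "largest_component_size (E \<omega>) ?\<Lambda> = 1"
      by (simp add: cluster_empty_edges)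
    with \<omega>(3) size show "\<omega> \<in> {}" by simp
  qed
  moreover have "?N \<in> events" using config_event[OF K, of "\<lambda>F. F = {}"] .
  ultimately have "prob ?A + prob ?N = prob (?A \<union> ?N)"
    using large_component_event by (intro finite_measure_Union[symmetric]) auto
  also have "\<dots> \<le> 1" by simp
  finally show ?thesis using pos by (simp add: large_component_prob_def)
qed

lemma large_component_prob_upper:
  assumes \<rho>: "percolation_prob M E < \<rho>" "\<rho> < 1"
  obtains c where "c > 0" "eventually (\<lambda>n. large_component_prob M E \<rho> n \<le> exp (- c * real n)) sequentially"
proof -
  define \<theta> where "\<theta> = percolation_prob M E"
  have \<theta>0: "\<theta> \<ge> 0" by (simp add: \<theta>_def percolation_prob_def)
  \<comment> \<open>The gap is spent as follows: \<delta> for replacing \<theta> by the probability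
    at finite \<open>k\<close>, \<delta> for blocks sticking out of the box, \<delta> for the
    fluctuation of the block counts, \<delta> for the crossing edges, \<delta> for the additive
    \<open>k\<close>.\<close>
  define \<delta> where "\<delta> = (\<rho> - \<theta>) / 5"
  have \<delta>: "0 < \<delta>" "\<delta> < 1" "\<theta> + 5 * \<delta> = \<rho>" "\<theta> + \<delta> \<le> 1"
    using \<rho> \<theta>0 by (auto simp: \<delta>_def \<theta>_def field_simps)
  have "eventually (\<lambda>k. prob {\<omega> \<in> space M. has_cluster k (E \<omega>) 0} < \<theta> + \<delta>) sequentially"
    using \<delta>(1) unfolding \<theta>_def percolation_prob_def
    by (intro order_tendstoD(2)[OF has_cluster_prob_tendsto]) auto
  from eventually_happens'[OF sequentially_bot eventually_conj[OF this eventually_ge_at_top[of 1]]]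
  obtain k where k: "prob {\<omega> \<in> space M. has_cluster k (E \<omega>) 0} < \<theta> + \<delta>" "k \<ge> 1" by blast
  \<comment> \<open>The mean number of crossing edges will be at most
    \<open>2 * \<epsilon> * real n\<close>, the threshold is twice that, and each edge accounts for
    \<open>2 * k\<close> vertices: together \<open>8 * \<epsilon> * real k = \<delta>\<close> per
    unit of \<open>n\<close>.\<close>
  define \<epsilon> where "\<epsilon> = \<delta> / (8 * real k)"
  have \<epsilon>: "\<epsilon> > 0" "8 * \<epsilon> * real k = \<delta>" using \<delta>(1) k(2) by (auto simp: \<epsilon>_def)
  obtain L where L: "0 < L"
    "\<And>V U. finite V \<Longrightarrow> finite U \<Longrightarrow> block_index (int L) ` V \<subseteq> U \<Longrightarrow>
      (\<Sum>e\<in>crossing_pairs (block_index (int L)) V. edge_pr e) \<le> \<epsilon> * (real (card U) * real L ^ CARD('d))"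
    using crossing_mean_small[OF \<epsilon>(1)] by blast
  define l where "l = real L ^ CARD('d)"
  have l: "l > 0" using L by (simp add: l_def)
  let ?b = "block_index (int L) :: int ^ 'd \<Rightarrow> _"
  \<comment> \<open>The rates from Hoeffding's inequality and from the count of crossing edges,
    respectively.\<close>
  define c where "c = min (\<delta>\<^sup>2 / l) (\<epsilon> / 2)"
  have c: "c > 0" using l \<delta> \<epsilon> by (simp add: c_def)
  have "filterlim (\<lambda>n. c / 2 * real n) at_top sequentially"
    using c by (intro filterlim_tendsto_pos_mult_at_top[OF tendsto_const] filterlim_real_sequentially) auto
  then have ev1: "eventually (\<lambda>n. c / 2 * real n \<ge> ln 2) sequentially"
    by (simp add: filterlim_at_top)
  have "filterlim (\<lambda>n. \<delta> * real n) at_top sequentially"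
    using \<delta>(1) by (intro filterlim_tendsto_pos_mult_at_top[OF tendsto_const] filterlim_real_sequentially) auto
  then have ev2: "eventually (\<lambda>n. \<delta> * real n \<ge> real k) sequentially"
    by (simp add: filterlim_at_top)
  \<comment> \<open>Half of the rate is given up to absorb the factor 2 of the union bound.\<close>
  have "eventually (\<lambda>n. large_component_prob M E \<rho> n \<le> exp (- (c / 2) * real n)) sequentially"
    using ev1 ev2 lattice_box_blocks[OF L(1) \<delta>(1), where 'd = 'd] eventually_ge_at_top[of 1]
  proof eventually_elim
    case (elim n)
    let ?\<Lambda> = "lattice_box n :: (int ^ 'd) set"
    obtain U :: "(int ^ 'd) set" where U: "finite U" "?b ` ?\<Lambda> \<subseteq> U" "real (card U) * l \<le> (1 + \<delta>) * real n"
      using elim(3) unfolding l_def by blast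
    have Une: "U \<noteq> {}" using U(2) zero_in_lattice_box[of n] by blast
    have Ul: "real (card U) * l \<le> 2 * real n"
      using U(3) mult_right_mono[of "1 + \<delta>" 2 "real n"] \<delta>(2) by simp
    let ?B = "\<lambda>u. ?b -` {u}"
    let ?K = "\<lambda>u. {e \<in> vertex_pairs. e \<subseteq> ?B u}"
    let ?h = "\<lambda>u F. real (block_count k F (?B u))"
    let ?X = "crossing_pairs ?b ?\<Lambda>"
    have finB: "finite (?B u)" for u using L(1) by (intro finite_block) simp
    have cardB: "real (card (?B u)) = l" for u using L(1) by (simp add: card_block l_def)
    have X: "finite ?X" "?X \<subseteq> vertex_pairs"
      using finite_pairs_in[OF finite_lattice_box[of n]]
      by (auto simp: crossing_pairs_def intro: rev_finite_subset)
    define A1 where "A1 = {\<omega> \<in> space M. (\<theta> + 2 * \<delta>) * real n + \<delta> * real n \<le> (\<Sum>u\<in>U. ?h u (E \<omega> \<inter> ?K u))}"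
    define A2 where "A2 = {\<omega> \<in> space M. 4 * \<epsilon> * real n \<le> real (card (E \<omega> \<inter> ?X))}"
    \<comment> \<open>The restricted form shows the independence of the blocks; the unrestricted one
      is what \<open>card_cluster_le_blocks\<close> supplies.\<close>
    have restrict: "?h u (E \<omega> \<inter> ?K u) = ?h u (E \<omega>)" if "\<omega> \<in> space M" for \<omega> u
      using edges[OF that] by (simp add: block_count_restrict)
    have "prob A1 \<le> exp (- 2 * (\<delta> * real n)\<^sup>2 / (real (card U) * l\<^sup>2))"
      unfolding A1_def
    proof (rule prob_block_sum_ge[OF U(1) Une])
      show "finite (?K u) \<and> ?K u \<subseteq> vertex_pairs" for u using finB by (auto simp: finite_pairs_in)
      show "disjoint_family_on ?K U"
        unfolding disjoint_family_on_def
      proof (intro ballI impI equals0I)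
        fix u v e assume "u \<noteq> v" and e: "e \<in> ?K u \<inter> ?K v"
        from e obtain x where "x \<in> e" by (auto simp: vertex_pairs_def)
        with e \<open>u \<noteq> v\<close> show False by auto
      qed
      show "0 \<le> ?h u F \<and> ?h u F \<le> l" for u F
        using card_mono[OF finB, of "{y \<in> ?B u. k \<le> card (cluster (induced_subgraph F (?B u)) y)}" u]
        unfolding cardB[of u, symmetric] block_count_def by auto
      have "(\<Sum>u\<in>U. expectation (\<lambda>\<omega>. ?h u (E \<omega> \<inter> ?K u))) = (\<Sum>u\<in>U. expectation (\<lambda>\<omega>. ?h u (E \<omega>)))"
        using restrict by (intro sum.cong Bochner_Integration.integral_cong) auto
      also have "\<dots> \<le> (\<Sum>u\<in>U. l * (\<theta> + \<delta>))"
      proof (rule sum_mono)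
        fix u
        have "expectation (\<lambda>\<omega>. ?h u (E \<omega>)) \<le> l * prob {\<omega> \<in> space M. has_cluster k (E \<omega>) 0}"
          using expectation_block_count_le[OF finB] unfolding cardB .
        also have "\<dots> \<le> l * (\<theta> + \<delta>)" using k(1) l by (intro mult_left_mono) auto
        finally show "expectation (\<lambda>\<omega>. ?h u (E \<omega>)) \<le> l * (\<theta> + \<delta>)" .
      qed
      also have "\<dots> = (real (card U) * l) * (\<theta> + \<delta>)" by simp
      also have "\<dots> \<le> ((1 + \<delta>) * real n) * (\<theta> + \<delta>)"
        using U(3) \<theta>0 \<delta>(1) by (intro mult_right_mono) auto
      also have "\<dots> = (\<theta> + \<delta> + \<delta> * (\<theta> + \<delta>)) * real n" by (simp add: algebra_simps)
      also have "\<dots> \<le> (\<theta> + \<delta> + \<delta> * 1) * real n"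
        using \<delta> by (intro mult_right_mono add_left_mono mult_left_mono) auto
      finally show "(\<Sum>u\<in>U. expectation (\<lambda>\<omega>. ?h u (E \<omega> \<inter> ?K u))) \<le> (\<theta> + 2 * \<delta>) * real n"
        by (simp add: add.commute)
    qed (use l \<delta>(1) in auto)
    also have "\<dots> \<le> exp (- c * real n)"
    proof -
      have "c * real n \<le> \<delta>\<^sup>2 / l * real n" by (intro mult_right_mono) (auto simp: c_def)
      also have "\<dots> = 2 * (\<delta> * real n)\<^sup>2 / (2 * real n * l)"
        using elim(4) l by (simp add: power2_eq_square field_simps)
      also have "\<dots> \<le> 2 * (\<delta> * real n)\<^sup>2 / (real (card U) * l * l)"
        using Ul l elim(4) U(1) Une by (intro divide_left_mono mult_right_mono mult_pos_pos) (auto simp: card_gt_0_iff)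
      finally show ?thesis by (simp add: power2_eq_square mult.assoc)
    qed
    finally have P1: "prob A1 \<le> exp (- c * real n)" .
    have "(\<Sum>e\<in>?X. edge_pr e) \<le> \<epsilon> * (real (card U) * l)"
      unfolding l_def using finite_lattice_box U by (intro L(2)) auto
    also have "\<dots> \<le> \<epsilon> * (2 * real n)" using Ul \<epsilon>(1) by (intro mult_left_mono) auto
    finally have mean: "(\<Sum>e\<in>?X. edge_pr e) \<le> 2 * \<epsilon> * real n" by simp
    have "prob A2 \<le> exp ((\<Sum>e\<in>?X. edge_pr e) - 4 * \<epsilon> * real n * ln 2)"
      unfolding A2_def using X by (rule prob_many_edges_le)
    also have "\<dots> \<le> exp (- c * real n)"
    proof -
      \<comment> \<open>The exponent is at most \<epsilon> n (2 - 8/3), that is -2/3 \<epsilon> n,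
        which lies below -1/2 \<epsilon> n.\<close>
      have "4 * \<epsilon> * real n * (2 / 3) \<le> 4 * \<epsilon> * real n * ln 2"
        using ln2_ge_two_thirds \<epsilon>(1) by (intro mult_left_mono) auto
      moreover have "c * real n \<le> \<epsilon> / 2 * real n"
        unfolding c_def by (intro mult_right_mono min.cobounded2) simp
      moreover have "0 \<le> \<epsilon> * real n" using \<epsilon>(1) by simp
      ultimately show ?thesis using mean by simp
    qed
    finally have P2: "prob A2 \<le> exp (- c * real n)" .
    have A12: "A1 \<in> events" "A2 \<in> events"
    proof -
      have "(\<lambda>\<omega>. \<Sum>u\<in>U. ?h u (E \<omega> \<inter> ?K u)) \<in> borel_measurable M"
        using finB by (intro borel_measurable_sum config_measurable) (auto simp: finite_pairs_in)
      then show "A1 \<in> events" by (simp add: A1_def borel_measurable_iff_ge)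
      show "A2 \<in> events" unfolding A2_def using X by (rule config_event)
    qed
    \<comment> \<open>Deterministic core: if there are few crossing edges, a large component forces
      a large sum of block counts.\<close>
    have "large_component_prob M E \<rho> n \<le> prob (A1 \<union> A2)"
      unfolding large_component_prob_def
    proof (rule finite_measure_mono)
      show "{\<omega> \<in> space M. \<rho> * real n < real (largest_component_size (E \<omega>) ?\<Lambda>)} \<subseteq> A1 \<union> A2"
      proof safe
        fix \<omega> assume \<omega>: "\<omega> \<in> space M" "\<rho> * real n < real (largest_component_size (E \<omega>) ?\<Lambda>)" "\<omega> \<notin> A2"
        let ?N = "card (E \<omega> \<inter> ?X)"
        have N: "real ?N \<le> 4 * \<epsilon> * real n" using \<omega> by (simp add: A2_def)
        obtain x where x: "x \<in> ?\<Lambda>" "largest_component_size (E \<omega>) ?\<Lambda> = card (cluster (induced_subgraph (E \<omega>) ?\<Lambda>) x)"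
          using largest_component_attained[OF finite_lattice_box] zero_in_lattice_box by blast
        have "largest_component_size (E \<omega>) ?\<Lambda>
            \<le> (\<Sum>u\<in>U. block_count k (E \<omega>) (?B u)) + (2 * ?N + 1) * k"
          unfolding x(2) using edges[OF \<omega>(1)] finite_lattice_box x(1) U(2,1) finB
          by (rule card_cluster_le_blocks)
        then have "real (largest_component_size (E \<omega>) ?\<Lambda>)
            \<le> real ((\<Sum>u\<in>U. block_count k (E \<omega>) (?B u)) + (2 * ?N + 1) * k)"
          by (simp only: of_nat_le_iff)
        also have "\<dots> = (\<Sum>u\<in>U. ?h u (E \<omega>)) + (2 * real ?N + 1) * real k"
          by (simp add: algebra_simps)
        also have "(2 * real ?N + 1) * real k \<le> (2 * (4 * \<epsilon> * real n) + 1) * real k"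
          using N by (intro mult_right_mono) auto
        also have "\<dots> = 8 * \<epsilon> * real k * real n + real k" by (simp add: algebra_simps)
        also have "\<dots> \<le> \<delta> * real n + \<delta> * real n" unfolding \<epsilon>(2) using elim(2) by simp
        finally have "\<rho> * real n \<le> (\<Sum>u\<in>U. ?h u (E \<omega>)) + 2 * \<delta> * real n"
          using \<omega>(2) by simp
        then have "(\<theta> + 2 * \<delta>) * real n + \<delta> * real n \<le> (\<Sum>u\<in>U. ?h u (E \<omega>))"
          unfolding \<delta>(3)[symmetric] by (simp add: algebra_simps)
        then show "\<omega> \<in> A1" using \<omega>(1) restrict by (simp add: A1_def)
      qed
    qed (use A12 in auto)
    also have "\<dots> \<le> prob A1 + prob A2" using A12 by (rule measure_Un_le)
    also have "\<dots> \<le> exp (ln 2) * exp (- c * real n)" using P1 P2 by simp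
    also have "\<dots> \<le> exp (c / 2 * real n) * exp (- c * real n)"
      using elim(1) by (intro mult_right_mono) (simp_all only: exp_le_cancel_iff exp_ge_zero)
    also have "\<dots> = exp (- (c / 2) * real n)" by (simp add: exp_add[symmetric] field_simps)
    finally show ?case .
  qed
  with c show ?thesis using that[of "c / 2"] by simp
qed

text \<open>The exponential upper bound fails to cover only finitely many \<open>n\<close>. Each of
  these has its own strictly positive rate by \<open>large_component_prob_less_1\<close>, so the
  minimum of all rates is a uniform one.\<close>

lemma large_component_prob_bounds:
  assumes \<rho>: "percolation_prob M E < \<rho>" "\<rho> < 1"
  shows "\<exists>A>0. \<forall>n\<ge>1. nondegenerate_size TYPE('d) \<rho> n \<longrightarrow>
      - A \<le> 1 / real n * ln (large_component_prob M E \<rho> n) \<and>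
      1 / real n * ln (large_component_prob M E \<rho> n) \<le> - (1 / A)"
proof -
  let ?P = "large_component_prob M E \<rho>"
  let ?D = "real CARD('d) * 2 ^ CARD('d)"
  have r: "r < 1" using \<rho> by (intro r_less_1) simp
  have low: "r powr (?D * real n) \<le> ?P n" if "n \<ge> 1" "nondegenerate_size TYPE('d) \<rho> n" for n
    using that by (intro large_component_prob_ge) (auto simp: nondegenerate_size_def)
  have pos: "0 < ?P n" if "n \<ge> 1" "nondegenerate_size TYPE('d) \<rho> n" for n
    using low[OF that] r_pos by (intro less_le_trans[OF _ low[OF that]]) simp
  have less1: "?P n < 1" if "nondegenerate_size TYPE('d) \<rho> n" for n
    using that r by (intro large_component_prob_less_1) (auto simp: nondegenerate_size_def)
  obtain c where c: "c > 0" "eventually (\<lambda>n. ?P n \<le> exp (- c * real n)) sequentially"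
    using large_component_prob_upper[OF \<rho>] by blast
  then obtain N where N: "\<And>n. n \<ge> N \<Longrightarrow> ?P n \<le> exp (- c * real n)"
    by (auto simp: eventually_sequentially)
  \<comment> \<open>Including \<open>c\<close> makes the set nonempty and lets the minimum serve for
    \<open>n \<ge> N\<close> as well.\<close>
  define S where "S = insert c ((\<lambda>n. - (ln (?P n) / real n)) ` {n \<in> {1..<N}. nondegenerate_size TYPE('d) \<rho> n})"
  define c' where "c' = Min S"
  have S: "finite S" "S \<noteq> {}" by (auto simp: S_def)
  have "\<forall>s\<in>S. s > 0"
    using c(1) pos less1 by (auto simp: S_def divide_neg_pos ln_less_zero)
  then have c': "c' > 0" unfolding c'_def using S by simp
  have up: "ln (?P n) / real n \<le> - c'" if n: "n \<ge> 1" "nondegenerate_size TYPE('d) \<rho> n" for n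
  proof (cases "n < N")
    case True
    then have "- (ln (?P n) / real n) \<in> S" using n by (auto simp: S_def)
    then have "c' \<le> - (ln (?P n) / real n)" unfolding c'_def using S by simp
    then show ?thesis by simp
  next
    case False
    then have "ln (?P n) \<le> ln (exp (- c * real n))"
      using N[of n] pos[OF n] by (subst ln_le_cancel_iff) auto
    then have "ln (?P n) / real n \<le> - c" using n(1) by (simp add: field_simps)
    moreover have "c' \<le> c" unfolding c'_def using S by (simp add: S_def)
    ultimately show ?thesis by linarith
  qed
  \<comment> \<open>The first entry serves the upper bound, the second is the exponential cost in
    \<open>large_component_prob_ge\<close>.\<close>
  define A where "A = max (1 / c') (?D * - ln r)"
  have A: "A > 0" "1 / A \<le> c'" "?D * - ln r \<le> A"
  proof -
    have "1 / c' \<le> A" by (simp add: A_def)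
    moreover have "1 / c' > 0" using c' by simp
    ultimately show "A > 0" by linarith
    with \<open>1 / c' \<le> A\<close> c' show "1 / A \<le> c'" by (simp add: field_simps)
  qed (simp add: A_def)
  have lo: "- A \<le> ln (?P n) / real n" if n: "n \<ge> 1" "nondegenerate_size TYPE('d) \<rho> n" for n
  proof -
    have "?D * real n * ln r = ln (r powr (?D * real n))" using r_pos by (simp add: ln_powr)
    also have "\<dots> \<le> ln (?P n)" using low[OF n] pos[OF n] r_pos by (subst ln_le_cancel_iff) auto
    finally have "?D * ln r \<le> ln (?P n) / real n" using n(1) by (simp add: field_simps)
    with A(3) show ?thesis by simp
  qed
  have "- A \<le> 1 / real n * ln (?P n) \<and> 1 / real n * ln (?P n) \<le> - (1 / A)"
    if "n \<ge> 1" "nondegenerate_size TYPE('d) \<rho> n" for n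
    using lo[OF that] up[OF that] A(2) by simp
  with A(1) show ?thesis by blast
qed

end

section \<open>The two models\<close>

lemma eucl_dist_eq: "eucl_dist x y = eucl_dist 0 (y - x)"
proof -
  have "(\<chi> i. real_of_int (x $ i - y $ i)) = - (\<chi> i. real_of_int (y $ i - x $ i))"
    by (simp add: vec_eq_iff)
  then have "eucl_dist x y = eucl_dist y x" unfolding eucl_dist_def by (metis norm_minus_cancel)
  also have "\<dots> = eucl_dist (y - x) 0" by (simp add: eucl_dist_def)
  also have "\<dots> = norm (- (\<chi> i. real_of_int (0 $ i - (y - x) $ i)))"
    unfolding eucl_dist_def by (intro arg_cong[of _ _ norm]) (simp add: vec_eq_iff)
  also have "\<dots> = eucl_dist 0 (y - x)" unfolding eucl_dist_def by (rule norm_minus_cancel)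
  finally show ?thesis .
qed

lemma eucl_dist_self: "eucl_dist x x = 0"
  by (simp add: eucl_dist_def zero_vec_def[symmetric])

lemma eucl_dist_axis: "eucl_dist 0 (axis i 1) = 1"
proof -
  have "(\<chi> j. real_of_int (0 $ j - axis i 1 $ j)) = - axis i (1 :: real)"
    by (auto simp: vec_eq_iff axis_def)
  then show ?thesis by (simp add: eucl_dist_def)
qed

lemma abs_component_le_eucl_dist: "real_of_int \<bar>z $ i\<bar> \<le> eucl_dist 0 z"
  using component_le_norm_cart[of "\<chi> i. real_of_int (0 $ i - z $ i)" i]
  by (simp add: eucl_dist_def)

lemma eucl_dist_ge_1:
  assumes "z \<noteq> 0"
  shows "1 \<le> eucl_dist 0 z"
proof -
  obtain i where "z $ i \<noteq> 0" using assms by (auto simp: vec_eq_iff)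
  then have "1 \<le> real_of_int \<bar>z $ i\<bar>" by linarith
  then show ?thesis using abs_component_le_eucl_dist[of z i] by linarith
qed

text \<open>The convergent series with exponent \<open>\<alpha> > 1\<close>, once for each sign;
  \<open>max 1\<close> makes the term at zero equal to 1.\<close>

lemma sum_int_powr_le:
  assumes "\<alpha> > 1"
  obtains C where "\<And>m :: nat. (\<Sum>j\<in>{- int m..int m}. max 1 \<bar>real_of_int j\<bar> powr - \<alpha>) \<le> C"
proof -
  let ?g = "\<lambda>j. max 1 \<bar>real_of_int j\<bar> powr - \<alpha>"
  have sm: "summable (\<lambda>k. real k powr - \<alpha>)"
    using assms by (simp add: summable_real_powr_iff)
  have "sum ?g {- int m..int m} \<le> 1 + 2 * (\<Sum>k. real k powr - \<alpha>)" for m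
  proof -
    have pos: "sum ?g {1..int m} \<le> (\<Sum>k. real k powr - \<alpha>)"
    proof -
      have "sum ?g {1..int m} = (\<Sum>k\<in>{1..m}. real k powr - \<alpha>)"
        by (rule sum.reindex_bij_witness[of _ int nat]) (auto simp: max_def)
      also have "\<dots> \<le> (\<Sum>k. real k powr - \<alpha>)"
        using sm by (intro sum_le_suminf) auto
      finally show ?thesis .
    qed
    have neg: "sum ?g {- int m..-1} = sum ?g {1..int m}"
      by (rule sum.reindex_bij_witness[of _ uminus uminus]) auto
    have "{- int m..int m} = insert 0 ({- int m..-1} \<union> {1..int m})" by auto
    then have "sum ?g {- int m..int m} = 1 + sum ?g {- int m..-1} + sum ?g {1..int m}"
      by (simp add: sum.union_disjoint)
    then show ?thesis using pos neg by linarith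
  qed
  then show ?thesis using that by blast
qed

text \<open>Distributivity; it reduces a product kernel on the lattice to its one-dimensional
  factor.\<close>

lemma sum_vec_prod:
  fixes g :: "'a \<Rightarrow> real"
  assumes "finite S"
  shows "(\<Sum>x\<in>{x :: 'a ^ 'd. \<forall>i. x $ i \<in> S}. \<Prod>i\<in>UNIV. g (x $ i)) = (\<Sum>j\<in>S. g j) ^ CARD('d)"
proof -
  have "(\<Sum>x\<in>{x :: 'a ^ 'd. \<forall>i. x $ i \<in> S}. \<Prod>i\<in>UNIV. g (x $ i))
      = (\<Sum>\<phi>\<in>PiE (UNIV :: 'd set) (\<lambda>_. S). \<Prod>i\<in>UNIV. g (\<phi> i))"
    by (rule sum.reindex_bij_witness[of _ vec_lambda vec_nth]) (auto simp: PiE_iff)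
  also have "\<dots> = (\<Prod>i\<in>(UNIV :: 'd set). \<Sum>j\<in>S. g j)"
    using assms by (subst prod_sum_PiE) auto
  finally show ?thesis by simp
qed

text \<open>The Euclidean norm of \<open>z \<noteq> 0\<close> is at least \<open>max 1 \<bar>z $ i\<bar>\<close> for every \<open>i\<close>, so the kernel is dominated
  by a product of one-dimensional ones.\<close>

lemma long_range_kernel_summable:
  assumes "0 < p" "0 < \<beta>" "1 < \<alpha>"
  shows "(\<lambda>z :: int ^ 'd. p * (min 1 (\<beta> / eucl_dist 0 z ^ CARD('d))) powr \<alpha>) summable_on UNIV"
    (is "?J summable_on UNIV")
proof -
  let ?g = "\<lambda>j :: int. max 1 \<bar>real_of_int j\<bar> powr - \<alpha>"
  have le: "?J z \<le> p * \<beta> powr \<alpha> * (\<Prod>i\<in>UNIV. ?g (z $ i))" for z :: "int ^ 'd"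
  proof (cases "z = 0")
    \<comment> \<open>Division by zero yields 0, so the kernel vanishes at the origin.\<close>
    case True
    then show ?thesis using assms by (simp add: eucl_dist_self prod_nonneg zero_power)
  next
    case False
    define D where "D = eucl_dist 0 z"
    have D: "D \<ge> 1" unfolding D_def using False by (rule eucl_dist_ge_1)
    have "(\<Prod>i\<in>UNIV. max 1 \<bar>real_of_int (z $ i)\<bar>) \<le> (\<Prod>i\<in>(UNIV :: 'd set). D)"
      using D abs_component_le_eucl_dist[of z] by (intro prod_mono) (auto simp: D_def)
    then have PD: "(\<Prod>i\<in>UNIV. max 1 \<bar>real_of_int (z $ i)\<bar>) \<le> D ^ CARD('d)" by simp
    have P: "(\<Prod>i\<in>UNIV. max 1 \<bar>real_of_int (z $ i)\<bar>) > 0" by (intro prod_pos) auto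
    have "min 1 (\<beta> / D ^ CARD('d)) \<le> \<beta> / (\<Prod>i\<in>UNIV. max 1 \<bar>real_of_int (z $ i)\<bar>)"
      using PD P D assms by (intro min.coboundedI2 divide_left_mono) auto
    then have "min 1 (\<beta> / D ^ CARD('d)) powr \<alpha> \<le> (\<beta> / (\<Prod>i\<in>UNIV. max 1 \<bar>real_of_int (z $ i)\<bar>)) powr \<alpha>"
      using D assms by (intro powr_mono2) auto
    also have "\<dots> = \<beta> powr \<alpha> * (\<Prod>i\<in>UNIV. max 1 \<bar>real_of_int (z $ i)\<bar>) powr - \<alpha>"
      using less_imp_le[OF P] assms by (simp add: powr_divide powr_minus_divide)
    also have "(\<Prod>i\<in>UNIV. max 1 \<bar>real_of_int (z $ i)\<bar>) powr - \<alpha> = (\<Prod>i\<in>UNIV. ?g (z $ i))"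
      by (rule prod_powr_distrib)
    finally show ?thesis using assms by (simp add: D_def mult.assoc)
  qed
  obtain C where C: "\<And>m :: nat. sum ?g {- int m..int m} \<le> C"
    using sum_int_powr_le[OF assms(3)] by blast
  have "sum ?J T \<le> p * \<beta> powr \<alpha> * C ^ CARD('d)" if "finite T" for T :: "(int ^ 'd) set"
  proof -
    define m where "m = nat (\<Sum>z\<in>T. \<Sum>i\<in>UNIV. \<bar>z $ i\<bar>)"
    have "\<bar>z $ i\<bar> \<le> int m" if "z \<in> T" for z i
    proof -
      have "\<bar>z $ i\<bar> \<le> (\<Sum>i\<in>UNIV. \<bar>z $ i\<bar>)" by (rule member_le_sum) auto
      also have "\<dots> \<le> (\<Sum>z\<in>T. \<Sum>i\<in>UNIV. \<bar>z $ i\<bar>)"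
        using that \<open>finite T\<close> by (intro member_le_sum) (auto intro: sum_nonneg)
      finally show ?thesis unfolding m_def by linarith
    qed
    then have "- int m \<le> z $ i \<and> z $ i \<le> int m" if "z \<in> T" for z i
      using that by (simp add: abs_le_iff minus_le_iff)
    then have T: "T \<subseteq> {z. \<forall>i. z $ i \<in> {- int m..int m}}" by auto
    have "sum ?J T \<le> (\<Sum>z\<in>T. p * \<beta> powr \<alpha> * (\<Prod>i\<in>UNIV. ?g (z $ i)))"
      by (intro sum_mono le)
    also have "\<dots> \<le> (\<Sum>z\<in>{z :: int ^ 'd. \<forall>i. z $ i \<in> {- int m..int m}}. p * \<beta> powr \<alpha> * (\<Prod>i\<in>UNIV. ?g (z $ i)))"
      using T assms card_vec_Collect(1)[of "{- int m..int m}", where 'd = 'd]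
      by (intro sum_mono2) (auto intro!: mult_nonneg_nonneg prod_nonneg)
    also have "\<dots> = p * \<beta> powr \<alpha> * sum ?g {- int m..int m} ^ CARD('d)"
      by (subst sum_vec_prod[symmetric]) (auto simp: sum_distrib_left)
    also have "\<dots> \<le> p * \<beta> powr \<alpha> * C ^ CARD('d)"
      using assms C by (intro mult_left_mono power_mono) (auto intro: sum_nonneg)
    finally show ?thesis .
  qed
  moreover have "?J z \<ge> 0" for z :: "int ^ 'd" using assms by simp
  ultimately show ?thesis
    by (intro nonneg_bdd_above_summable_on bdd_aboveI[of _ "p * \<beta> powr \<alpha> * C ^ CARD('d)"]) auto
qed

text \<open>The value \<open>r\<close> is the kernel at distance one. It is maximal because nonzero
  lattice points have norm at least 1, and because at the origin the convention for division by zero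
  gives 0.\<close>

lemma (in long_range_percolation) invariant:
  "invariant_percolation M E (\<lambda>x y. p * (min 1 (\<beta> / eucl_dist x y ^ CARD('d))) powr \<alpha>)
    (\<lambda>z. p * (min 1 (\<beta> / eucl_dist 0 z ^ CARD('d))) powr \<alpha>) (p * min 1 \<beta> powr \<alpha>)"
proof
  fix x y z :: "int ^ 'd" and i :: 'd
  show "p * (min 1 (\<beta> / eucl_dist x y ^ CARD('d))) powr \<alpha>
      = p * (min 1 (\<beta> / eucl_dist 0 (y - x) ^ CARD('d))) powr \<alpha>"
    by (subst eucl_dist_eq) simp
  show "0 \<le> p * (min 1 (\<beta> / eucl_dist 0 z ^ CARD('d))) powr \<alpha>" using p by simp
  show "(\<lambda>z :: int ^ 'd. p * (min 1 (\<beta> / eucl_dist 0 z ^ CARD('d))) powr \<alpha>) summable_on UNIV"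
    using p(1) \<beta> \<alpha> by (rule long_range_kernel_summable)
  show "p * (min 1 (\<beta> / eucl_dist 0 (axis i 1 :: int ^ 'd) ^ CARD('d))) powr \<alpha> = p * min 1 \<beta> powr \<alpha>"
    by (simp add: eucl_dist_axis)
  show "0 < p * min 1 \<beta> powr \<alpha>" using p \<beta> by simp
  show "p * (min 1 (\<beta> / eucl_dist 0 z ^ CARD('d))) powr \<alpha> \<le> p * min 1 \<beta> powr \<alpha>"
  proof (cases "z = 0")
    case True
    then show ?thesis using p by (simp add: eucl_dist_self zero_power)
  next
    case False
    then have "1 \<le> eucl_dist 0 z ^ CARD('d)" by (intro one_le_power eucl_dist_ge_1)
    then have "\<beta> / eucl_dist 0 z ^ CARD('d) \<le> \<beta>" "0 \<le> \<beta> / eucl_dist 0 z ^ CARD('d)"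
      using \<beta> by (auto simp: divide_le_eq mult_le_cancel_left1)
    then show ?thesis using p \<alpha> by (intro mult_left_mono powr_mono2) auto
  qed
qed

text \<open>Summability is trivial here: points at distance one have coordinates between -1 and 1,
  so the kernel has finite support.\<close>

lemma (in nearest_neighbor_percolation) invariant:
  "invariant_percolation M E (\<lambda>x y. if eucl_dist x y = 1 then q else 0)
    (\<lambda>z. if eucl_dist 0 z = 1 then q else 0) q"
proof
  fix x y z :: "int ^ 'd" and i :: 'd
  show "(if eucl_dist x y = 1 then q else 0) = (if eucl_dist 0 (y - x) = 1 then q else 0)"
    by (subst eucl_dist_eq) simp
  have "{z :: int ^ 'd. eucl_dist 0 z = 1} \<subseteq> {z. \<forall>i. z $ i \<in> {-1..1}}"
  proof safe
    fix z :: "int ^ 'd" and i assume "eucl_dist 0 z = 1"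
    then have "real_of_int \<bar>z $ i\<bar> \<le> 1" using abs_component_le_eucl_dist[of z i] by simp
    then show "z $ i \<in> {-1..1}" by auto
  qed
  then have "finite {z :: int ^ 'd. eucl_dist 0 z = 1}"
    using card_vec_Collect(1)[of "{-1..1 :: int}", where 'd = 'd] by (rule finite_subset) simp
  then have "(\<lambda>z :: int ^ 'd. if eucl_dist 0 z = 1 then q else 0) summable_on {z. eucl_dist 0 z = 1}"
    by (rule summable_on_finite)
  then show "(\<lambda>z :: int ^ 'd. if eucl_dist 0 z = 1 then q else 0) summable_on UNIV"
    by (rule summable_on_cong_neutral[THEN iffD1, rotated -1]) auto
qed (use q in \<open>auto simp: eucl_dist_axis\<close>)

theorem theorem2p4:
  fixes M :: "'w measure"
    and E :: "'w \<Rightarrow> (int ^ 'd) set set"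
    and p \<beta> \<alpha> q :: real
  assumes "long_range_percolation M E p \<beta> \<alpha> \<or> nearest_neighbor_percolation M E q"
    and "percolation_prob M E < 1"
  shows "\<forall>\<rho>\<in>{percolation_prob M E <..< 1}. \<exists>A>0. \<forall>n\<ge>1.
    nondegenerate_size TYPE('d) \<rho> n \<longrightarrow>
      - A \<le> 1 / real n * ln (large_component_prob M E \<rho> n) \<and>
      1 / real n * ln (large_component_prob M E \<rho> n) \<le> - (1 / A)"
proof -
  obtain \<kappa> J r where "invariant_percolation M E \<kappa> J r"
    using assms(1) long_range_percolation.invariant nearest_neighbor_percolation.invariant by blast
  then interpret invariant_percolation M E \<kappa> J r .
  show ?thesis using large_component_prob_bounds by simp
qed

end
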